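(* Consider the $n$-player stopping game with private information, reward function $f$ and starting positions $\vec x=(x_1,\dots,x_n)\in\mathbb{R}^n$ described in the context. Suppose $f(x)<0$ for $x<0$, $f(x)\ge 0$ for $x\ge 0$, and $\liminf_{x\to\infty} f(x)/x^{\gamma}>0$ for some $\gamma>0$. Then there exist infinitely many Nash equilibria with infinite expected payoffs for all players. In particular, the vectors of stopping times $(\tau_a^{(1)},\dots,\tau_a^{(n)})$, where $$\tau_a^{(i)}:=\inf\Big\{s\ge \sigma^{(i)}_{-x_i}:\ x_i+W^{(i)}_s\ge a\sqrt{s-\sigma^{(i)}_{-x_i}+1}\Big\},\qquad \sigma^{(i)}_{\xi}:=\inf\{t\ge 0: W^{(i)}_t=\xi\},$$ constitute Nash equilibria with infinite expected payoffs, provided that $a>0$ is large enough so that $\beta(a)<\frac{\gamma}{2n}$, where $\beta(\cdot)$ is the function described in the context.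
   Context: Let $(\Omega,\mathcal{F},\mathbb{P})$ be a probability space carrying $n$ independent standard Brownian motions $W^{(1)},\dots,W^{(n)}$, with natural filtrations $\mathbb{F}^{(1)},\dots,\mathbb{F}^{(n)}$. Let $f:\mathbb{R}\to\mathbb{R}$ be a reward function and $\vec x=(x_1,\dots,x_n)\in\mathbb{R}^n$ the vector of starting positions. Player $i$ chooses $\tau_i\in\mathcal{T}_i$, the set of all $\mathbb{F}^{(i)}$-stopping times with values in $[0,\infty]$ such that $\mathbb{E}[f(x_i+W^{(i)}_{\tau_i})]$ is well defined. The player who stops first receives the reward $f$ evaluated at his stopping position. With $\vec\tau=(\tau_1,\dots,\tau_n)$, the expected payoff that player $i$ wants to maximize is $$J_i(\vec\tau,\vec x)=\mathbb{E}\Big[f\big(x_i+W^{(i)}_{\tau_i}\big)\,c_i(\tau_i)\Big],\qquad c_i(t):=\prod_{j\ne i}\mathbb{P}(\tau_j>t)+d_i(t),\quad 0\le t<\infty,$$ with the convention $c_i(\infty)=0$, where $d_i(t)\ge 0$ is a term accounting for winning in case of ties between players; its explicit form is left unspecified, and it is only assumed to be nonnegative. A vector $(\tau_1,\dots,\tau_n)\in\prod_i\mathcal{T}_i$ is a Nash equilibrium if no player $i$ can strictly increase his expected payoff $J_i$ by replacing $\tau_i$ by another element of $\mathcal{T}_i$ while the other players' stopping times are kept fixed. The function $\beta$: for a standard Brownian motion $\widetilde W$ and $\widetilde\tau_a:=\inf\{t\ge 0:\widetilde W_t\ge a\sqrt{t+1}\}$, a theorem of Breiman (1966) yields a constant $c>0$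 and a positive function $\beta$ such that $\mathbb{P}(\widetilde\tau_a>t-1)\ge c\,t^{-\beta(a)}$ for all $t$ large enough, and $\lim_{a\to\infty}\beta(a)=0$. *)

theory Defs
  imports "HOL-Probability.Probability"
begin

text \<open>
  Processes are functions \<open>W :: real \<Rightarrow> '\<omega> \<Rightarrow> real\<close>, used only at times \<open>t \<ge> 0\<close>. Random times with
  values in \<open>[0, \<infinity>]\<close> are \<open>ennreal\<close>-valued, and filtrations are indexed by \<open>ennreal\<close>, so that the
  library notion \<^const>\<open>stopping_time\<close> applies (its condition at \<open>\<infinity>\<close> is void).
  Players are the elements of a finite type \<open>'n\<close>.
\<close>

definition natural_filtration ::
    "'\<omega> measure \<Rightarrow> (real \<Rightarrow> '\<omega> \<Rightarrow> real) \<Rightarrow> ennreal \<Rightarrow> '\<omega> measure" where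
  "natural_filtration M W t =
     sigma (space M)
       {W s -` A \<inter> space M | s A. 0 \<le> s \<and> ennreal s \<le> t \<and> A \<in> sets borel}"

text \<open>All paths are continuous, so that hitting times of closed sets are stopping times of the
  uncompleted natural filtration; the process starts at \<open>0\<close> almost surely.\<close>

definition standard_brownian_motion ::
    "'\<omega> measure \<Rightarrow> (real \<Rightarrow> '\<omega> \<Rightarrow> real) \<Rightarrow> bool" where
  "standard_brownian_motion M W \<longleftrightarrow>
     prob_space M \<and>
     (\<forall>t\<ge>0. W t \<in> borel_measurable M) \<and>
     (AE \<omega> in M. W 0 \<omega> = 0) \<and>
     (\<forall>\<omega>\<in>space M. continuous_on {0..} (\<lambda>t. W t \<omega>)) \<and>
     (\<forall>s t. 0 \<le> s \<and> s < t \<longrightarrow>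
        distributed M lborel (\<lambda>\<omega>. W t \<omega> - W s \<omega>)
          (\<lambda>y. ennreal (normal_density 0 (sqrt (t - s)) y)) \<and>
        prob_space.indep_set M
          (sets (natural_filtration M W (ennreal s)))
          (sets (vimage_algebra (space M) (\<lambda>\<omega>. W t \<omega> - W s \<omega>) borel)))"

definition independent_brownian_motions ::
    "'\<omega> measure \<Rightarrow> ('n::finite \<Rightarrow> real \<Rightarrow> '\<omega> \<Rightarrow> real) \<Rightarrow> bool" where
  "independent_brownian_motions M W \<longleftrightarrow>
     prob_space M \<and>
     (\<forall>i. standard_brownian_motion M (W i)) \<and>
     prob_space.indep_sets M (\<lambda>i. sets (natural_filtration M (W i) \<infinity>)) UNIV"

text \<open>Expectations with values in \<open>[-\<infinity>, \<infinity>]\<close>. The value of \<open>ext_expectation\<close> is only meaningful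
  together with \<open>expectation_well_defined\<close>, since \<open>\<infinity> - \<infinity> = \<infinity>\<close> in \<^typ>\<open>ereal\<close>.\<close>

definition expectation_well_defined :: "'\<omega> measure \<Rightarrow> ('\<omega> \<Rightarrow> real) \<Rightarrow> bool" where
  "expectation_well_defined M X \<longleftrightarrow>
     (\<integral>\<^sup>+\<omega>. ennreal (X \<omega>) \<partial>M) < \<infinity> \<or> (\<integral>\<^sup>+\<omega>. ennreal (- X \<omega>) \<partial>M) < \<infinity>"

definition ext_expectation :: "'\<omega> measure \<Rightarrow> ('\<omega> \<Rightarrow> real) \<Rightarrow> ereal" where
  "ext_expectation M X =
     enn2ereal (\<integral>\<^sup>+\<omega>. ennreal (X \<omega>) \<partial>M) - enn2ereal (\<integral>\<^sup>+\<omega>. ennreal (- X \<omega>) \<partial>M)"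

text \<open>A player who never stops gets reward \<open>0\<close>.\<close>

definition stopped_reward ::
    "(real \<Rightarrow> real) \<Rightarrow> real \<Rightarrow> (real \<Rightarrow> '\<omega> \<Rightarrow> real) \<Rightarrow> ('\<omega> \<Rightarrow> ennreal) \<Rightarrow> '\<omega> \<Rightarrow> real" where
  "stopped_reward f x W \<tau> \<omega> =
     (if \<tau> \<omega> = \<infinity> then 0 else f (x + W (enn2real (\<tau> \<omega>)) \<omega>))"

definition admissible_times ::
    "'\<omega> measure \<Rightarrow> (real \<Rightarrow> real) \<Rightarrow> real \<Rightarrow> (real \<Rightarrow> '\<omega> \<Rightarrow> real) \<Rightarrow> ('\<omega> \<Rightarrow> ennreal) set" where
  "admissible_times M f x W =
     {\<tau>. stopping_time (natural_filtration M W) \<tau> \<and>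
         expectation_well_defined M (stopped_reward f x W \<tau>)}"

definition strategy_profiles ::
    "'\<omega> measure \<Rightarrow> (real \<Rightarrow> real) \<Rightarrow> ('n::finite \<Rightarrow> real) \<Rightarrow> ('n \<Rightarrow> real \<Rightarrow> '\<omega> \<Rightarrow> real)
      \<Rightarrow> ('n \<Rightarrow> '\<omega> \<Rightarrow> ennreal) set" where
  "strategy_profiles M f x W = {\<tau>. \<forall>i. \<tau> i \<in> admissible_times M f (x i) (W i)}"

text \<open>The tie term \<open>d i \<tau> t\<close> is a parameter; it may depend on the player, on the strategy profile
  and on time.\<close>

definition win_weight ::
    "'\<omega> measure \<Rightarrow> ('n::finite \<Rightarrow> ('n \<Rightarrow> '\<omega> \<Rightarrow> ennreal) \<Rightarrow> real \<Rightarrow> real)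
      \<Rightarrow> ('n \<Rightarrow> '\<omega> \<Rightarrow> ennreal) \<Rightarrow> 'n \<Rightarrow> ennreal \<Rightarrow> real" where
  "win_weight M d \<tau> i t =
     (if t = \<infinity> then 0
      else (\<Prod>j\<in>UNIV - {i}. measure M {\<omega> \<in> space M. \<tau> j \<omega> > t}) + d i \<tau> (enn2real t))"

definition weighted_reward ::
    "'\<omega> measure \<Rightarrow> (real \<Rightarrow> real) \<Rightarrow> ('n::finite \<Rightarrow> real) \<Rightarrow> ('n \<Rightarrow> real \<Rightarrow> '\<omega> \<Rightarrow> real)
      \<Rightarrow> ('n \<Rightarrow> ('n \<Rightarrow> '\<omega> \<Rightarrow> ennreal) \<Rightarrow> real \<Rightarrow> real)
      \<Rightarrow> ('n \<Rightarrow> '\<omega> \<Rightarrow> ennreal) \<Rightarrow> 'n \<Rightarrow> '\<omega> \<Rightarrow> real" where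
  "weighted_reward M f x W d \<tau> i \<omega> =
     stopped_reward f (x i) (W i) (\<tau> i) \<omega> * win_weight M d \<tau> i (\<tau> i \<omega>)"

definition payoff ::
    "'\<omega> measure \<Rightarrow> (real \<Rightarrow> real) \<Rightarrow> ('n::finite \<Rightarrow> real) \<Rightarrow> ('n \<Rightarrow> real \<Rightarrow> '\<omega> \<Rightarrow> real)
      \<Rightarrow> ('n \<Rightarrow> ('n \<Rightarrow> '\<omega> \<Rightarrow> ennreal) \<Rightarrow> real \<Rightarrow> real)
      \<Rightarrow> ('n \<Rightarrow> '\<omega> \<Rightarrow> ennreal) \<Rightarrow> 'n \<Rightarrow> ereal" where
  "payoff M f x W d \<tau> i = ext_expectation M (weighted_reward M f x W d \<tau> i)"

definition nash_equilibrium ::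
    "'\<omega> measure \<Rightarrow> (real \<Rightarrow> real) \<Rightarrow> ('n::finite \<Rightarrow> real) \<Rightarrow> ('n \<Rightarrow> real \<Rightarrow> '\<omega> \<Rightarrow> real)
      \<Rightarrow> ('n \<Rightarrow> ('n \<Rightarrow> '\<omega> \<Rightarrow> ennreal) \<Rightarrow> real \<Rightarrow> real)
      \<Rightarrow> ('n \<Rightarrow> '\<omega> \<Rightarrow> ennreal) \<Rightarrow> bool" where
  "nash_equilibrium M f x W d \<tau> \<longleftrightarrow>
     \<tau> \<in> strategy_profiles M f x W \<and>
     (\<forall>i. \<forall>\<rho>\<in>admissible_times M f (x i) (W i).
        \<not> payoff M f x W d \<tau> i < payoff M f x W d (\<tau>(i := \<rho>)) i)"

definition infinite_payoffs ::
    "'\<omega> measure \<Rightarrow> (real \<Rightarrow> real) \<Rightarrow> ('n::finite \<Rightarrow> real) \<Rightarrow> ('n \<Rightarrow> real \<Rightarrow> '\<omega> \<Rightarrow> real)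
      \<Rightarrow> ('n \<Rightarrow> ('n \<Rightarrow> '\<omega> \<Rightarrow> ennreal) \<Rightarrow> real \<Rightarrow> real)
      \<Rightarrow> ('n \<Rightarrow> '\<omega> \<Rightarrow> ennreal) \<Rightarrow> bool" where
  "infinite_payoffs M f x W d \<tau> \<longleftrightarrow>
     (\<forall>i. expectation_well_defined M (weighted_reward M f x W d \<tau> i) \<and>
          payoff M f x W d \<tau> i = \<infinity>)"

definition hitting_time :: "(real \<Rightarrow> '\<omega> \<Rightarrow> real) \<Rightarrow> real \<Rightarrow> '\<omega> \<Rightarrow> ennreal" where
  "hitting_time W \<xi> \<omega> = Inf {ennreal t | t. 0 \<le> t \<and> W t \<omega> = \<xi>}"

text \<open>If level \<open>-x\<close> is never hit, the set below is empty and the infimum is \<open>\<infinity>\<close>; hence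
  \<^const>\<open>enn2real\<close> is only applied to finite times.\<close>

definition sqrt_boundary_time ::
    "real \<Rightarrow> real \<Rightarrow> (real \<Rightarrow> '\<omega> \<Rightarrow> real) \<Rightarrow> '\<omega> \<Rightarrow> ennreal" where
  "sqrt_boundary_time a x W \<omega> =
     Inf {ennreal s | s. 0 \<le> s \<and> hitting_time W (- x) \<omega> \<le> ennreal s \<and>
            x + W s \<omega> \<ge> a * sqrt (s - enn2real (hitting_time W (- x) \<omega>) + 1)}"

definition breiman_time :: "real \<Rightarrow> (real \<Rightarrow> '\<omega> \<Rightarrow> real) \<Rightarrow> '\<omega> \<Rightarrow> ennreal" where
  "breiman_time a W \<omega> = Inf {ennreal t | t. 0 \<le> t \<and> W t \<omega> \<ge> a * sqrt (t + 1)}"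

text \<open>\<open>breiman_exponent N B \<beta>\<close>: the function \<open>\<beta>\<close> (considered on \<open>a > 0\<close>) has the properties
  provided by Breiman's theorem for the Brownian motion \<open>B\<close>. The constant \<open>c\<close> may depend on \<open>a\<close>.\<close>

definition breiman_exponent ::
    "'\<omega> measure \<Rightarrow> (real \<Rightarrow> '\<omega> \<Rightarrow> real) \<Rightarrow> (real \<Rightarrow> real) \<Rightarrow> bool" where
  "breiman_exponent N B \<beta> \<longleftrightarrow>
     (\<forall>a>0. \<beta> a > 0) \<and>
     (\<forall>a>0. \<exists>c>0. \<forall>\<^sub>F t in at_top.
        measure N {\<omega> \<in> space N. breiman_time a B \<omega> > ennreal (t - 1)} \<ge> c * t powr (- \<beta> a)) \<and>
     (\<beta> \<longlongrightarrow> 0) at_top"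

end

theory Submission
  imports Defs
begin

text \<open>
  The equilibria are profiles \<open>\<tau>\<^sub>a\<close> in which every player has payoff \<open>\<infinity>\<close>, so that no deviation can
  pay off. A player who stops at a late time \<open>t\<close> does so at a height of order \<open>sqrt t\<close>, which yields
  a reward of order \<open>t powr (\<gamma> / 2)\<close>. If every player survives time \<open>t\<close> with probability at least of order
  \<open>t powr - b\<close>, stopping after time \<open>u\<close> contributes at least the order of
  \<open>u powr (\<gamma> / 2 - (n - 1) * b - b)\<close> to the payoff, and this tends to \<open>\<infinity>\<close> if \<open>b < \<gamma> / (2 * n)\<close>.

  The survival bound is transferred from the Brownian motion \<open>B\<close> to the players by the Markov property
  at a fixed time \<open>K\<close>: with positive probability a player has hit \<open>0\<close> by time \<open>K\<close>, has not stopped,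
  and is at or below \<open>0\<close> at time \<open>K\<close>; then it survives as long as the path restarted at \<open>K\<close> stays below
  Breiman's boundary. That some \<open>a\<close> satisfy the survival bound with small \<open>b\<close> is proved directly,
  by Brownian scaling on a geometric grid of times.
\<close>

section \<open>Increments of a Brownian motion\<close>

text \<open>Survival estimates concern \<open>B\<close> on \<open>N\<close>, while the players live
  on \<open>M\<close>, so path events are compared across probability spaces. Independence of
  increments fixes the joint law at finitely many grid times, and continuity of paths does the rest:
  a strict inequality on a compact interval is a weak inequality at all dyadic points with some
  uniform margin \<open>1 / Suc k\<close>. The same description keeps first passage events in the
  uncompleted filtration.

  Survival alone earns nothing, since never stopping has weight 0. What pays is late but finite
  stopping, so the survival bound is combined with almost sure crossing of the boundary. The height
  at a late stop is counted from the hitting time, which is why the initial event also bounds that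
  time by the constant \<open>K\<close>.

  There are infinitely many equilibria because a continuous path leaving 0 meets the lower of two
  square root boundaries strictly first; profiles for different \<open>a\<close> therefore differ
  wherever stopping is finite.\<close>

lemma space_natural_filtration [simp]: "space (natural_filtration M W t) = space M"
  unfolding natural_filtration_def by (rule space_measure_of) auto

lemma sets_natural_filtration:
  "sets (natural_filtration M W t) =
     sigma_sets (space M) {W s -` A \<inter> space M | s A. 0 \<le> s \<and> ennreal s \<le> t \<and> A \<in> sets borel}"
  unfolding natural_filtration_def by (rule sets_measure_of) auto

lemma natural_filtration_mono:
  "t \<le> t' \<Longrightarrow> sets (natural_filtration M W t) \<subseteq> sets (natural_filtration M W t')"
  unfolding sets_natural_filtration by (rule sigma_sets_mono') (auto intro: order_trans)

lemma measurable_natural_filtration: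
  assumes "0 \<le> s" "ennreal s \<le> t"
  shows "W s \<in> borel_measurable (natural_filtration M W t)"
  using assms by (intro measurableI) (auto simp: sets_natural_filtration intro!: sigma_sets.Basic)

locale brownian_motion = prob_space M for M :: "'w measure" and W :: "real \<Rightarrow> 'w \<Rightarrow> real" +
  assumes standard: "standard_brownian_motion M W"
begin

abbreviation F :: "real \<Rightarrow> 'w measure" where
  "F s \<equiv> natural_filtration M W (ennreal s)"

lemma measurable_W [measurable]: "0 \<le> t \<Longrightarrow> W t \<in> borel_measurable M"
  using standard by (auto simp: standard_brownian_motion_def)

lemma AE_start: "AE \<omega> in M. W 0 \<omega> = 0"
  using standard by (auto simp: standard_brownian_motion_def)

lemma continuous_path: "\<omega> \<in> space M \<Longrightarrow> continuous_on {0..} (\<lambda>t. W t \<omega>)"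
  using standard by (auto simp: standard_brownian_motion_def)

lemma sets_filtration_subset: "sets (natural_filtration M W t) \<subseteq> sets M"
  unfolding sets_natural_filtration
  by (rule sets.sigma_sets_subset) (auto intro!: measurable_sets)

lemma sets_filtrationD: "A \<in> sets (natural_filtration M W t) \<Longrightarrow> A \<in> sets M"
  using sets_filtration_subset by blast

lemma measurable_F: "0 \<le> s \<Longrightarrow> s \<le> t \<Longrightarrow> W s \<in> borel_measurable (F t)"
  by (intro measurable_natural_filtration) (auto simp: ennreal_leI)

lemma F_mono: "s \<le> t \<Longrightarrow> A \<in> sets (F s) \<Longrightarrow> A \<in> sets (F t)"
  using natural_filtration_mono[of "ennreal s" "ennreal t" M W] by (auto simp: ennreal_leI)

lemma measurable_from_F: "f \<in> measurable (natural_filtration M W t) N \<Longrightarrow> f \<in> measurable M N"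
  using sets_filtration_subset by (auto simp: measurable_def)

lemma increment_normal:
  "0 \<le> s \<Longrightarrow> s < t \<Longrightarrow> distributed M lborel (\<lambda>\<omega>. W t \<omega> - W s \<omega>) (normal_density 0 (sqrt (t - s)))"
  using standard by (auto simp: standard_brownian_motion_def)

lemma increment_indep:
  assumes "0 \<le> s" "s < t" "A \<in> sets (F s)" "C \<in> sets borel"
  shows "prob (A \<inter> {\<omega> \<in> space M. W t \<omega> - W s \<omega> \<in> C}) = prob A * prob {\<omega> \<in> space M. W t \<omega> - W s \<omega> \<in> C}"
proof -
  have "indep_set (sets (F s)) (sets (vimage_algebra (space M) (\<lambda>\<omega>. W t \<omega> - W s \<omega>) borel))"
    using standard assms by (auto simp: standard_brownian_motion_def)
  moreover have "{\<omega> \<in> space M. W t \<omega> - W s \<omega> \<in> C} \<in>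
      sets (vimage_algebra (space M) (\<lambda>\<omega>. W t \<omega> - W s \<omega>) borel)"
    using in_vimage_algebra[OF assms(4), of "\<lambda>\<omega>. W t \<omega> - W s \<omega>" "space M"]
    by (simp add: vimage_def Int_def conj_commute)
  ultimately show ?thesis
    using assms(3) by (intro indep_setD)
qed

text \<open>The freezing lemma: by independence, the past and the increment have a product law, so
  Tonelli allows the increment to be integrated out with the past held fixed.\<close>

lemma nn_integral_increment:
  assumes "0 \<le> s" "s < t" and \<Phi>: "\<Phi> \<in> borel_measurable (F s \<Otimes>\<^sub>M borel)"
  shows "(\<integral>\<^sup>+\<omega>. \<Phi> (\<omega>, W t \<omega> - W s \<omega>) \<partial>M) =
         (\<integral>\<^sup>+\<omega>. \<integral>\<^sup>+z. \<Phi> (\<omega>, z) \<partial>density lborel (normal_density 0 (sqrt (t - s))) \<partial>M)"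
proof -
  let ?D = "\<lambda>\<omega>. W t \<omega> - W s \<omega>"
  let ?\<nu> = "density lborel (normal_density 0 (sqrt (t - s)))"
  have [measurable]: "?D \<in> borel_measurable M"
    using assms(1,2) by (intro borel_measurable_diff measurable_W) auto
  \<comment> \<open>The sample point itself serves as a random element with values in the coarser
    measurable space \<open>F s\<close>; its law stands for the whole past.\<close>
  have id_meas: "(\<lambda>\<omega>. \<omega>) \<in> measurable M (F s)"
    by (rule measurable_from_F[of _ "ennreal s"]) simp
  interpret D: prob_space "distr M borel ?D"
    by (rule prob_space_distr) measurable
  have "distr M borel ?D = distr M lborel ?D"
    by (rule distr_cong) auto
  also have "\<dots> = ?\<nu>"
    using increment_normal[OF assms(1,2)] by (rule distributed_distr_eq_density)
  finally have distr_D: "distr M borel ?D = ?\<nu>" .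
  have meas_pair: "(\<lambda>\<omega>. (\<omega>, ?D \<omega>)) \<in> measurable M (F s \<Otimes>\<^sub>M borel)"
    using id_meas by measurable
  interpret id: prob_space "distr M (F s) (\<lambda>\<omega>. \<omega>)"
    by (rule prob_space_distr) (rule id_meas)
  have pair: "distr M (F s) (\<lambda>\<omega>. \<omega>) \<Otimes>\<^sub>M distr M borel ?D = distr M (F s \<Otimes>\<^sub>M borel) (\<lambda>\<omega>. (\<omega>, ?D \<omega>))"
  proof (rule pair_measure_eqI)
    fix A C assume "A \<in> sets (distr M (F s) (\<lambda>\<omega>. \<omega>))" "C \<in> sets (distr M borel ?D)"
    then have AC: "A \<in> sets (F s)" "C \<in> sets borel" by auto
    then have "A \<subseteq> space M"
      using sets.sets_into_space by fastforce
    then have eq: "(\<lambda>\<omega>. (\<omega>, ?D \<omega>)) -` (A \<times> C) \<inter> space M = A \<inter> {\<omega> \<in> space M. ?D \<omega> \<in> C}"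
      "(\<lambda>\<omega>. \<omega>) -` A \<inter> space M = A" "?D -` C \<inter> space M = {\<omega> \<in> space M. ?D \<omega> \<in> C}"
      by auto
    show "emeasure (distr M (F s) (\<lambda>\<omega>. \<omega>)) A * emeasure (distr M borel ?D) C =
        emeasure (distr M (F s \<Otimes>\<^sub>M borel) (\<lambda>\<omega>. (\<omega>, ?D \<omega>))) (A \<times> C)"
      using AC id_meas meas_pair increment_indep[OF assms(1,2) AC]
      by (simp add: emeasure_distr eq emeasure_eq_measure ennreal_mult inf.absorb1 \<open>A \<subseteq> space M\<close>)
  qed (auto intro: id.sigma_finite_measure_axioms D.sigma_finite_measure_axioms cong: sets_pair_measure_cong)
  have \<Phi>': "\<Phi> \<in> borel_measurable (distr M (F s) (\<lambda>\<omega>. \<omega>) \<Otimes>\<^sub>M distr M borel ?D)"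
    using \<Phi> by (simp add: measurable_distr_eq1 cong: measurable_cong_sets)
  have "(\<integral>\<^sup>+\<omega>. \<Phi> (\<omega>, ?D \<omega>) \<partial>M) = (\<integral>\<^sup>+p. \<Phi> p \<partial>distr M (F s \<Otimes>\<^sub>M borel) (\<lambda>\<omega>. (\<omega>, ?D \<omega>)))"
    using meas_pair \<Phi> by (simp add: nn_integral_distr)
  also have "\<dots> = (\<integral>\<^sup>+\<omega>. \<integral>\<^sup>+z. \<Phi> (\<omega>, z) \<partial>distr M borel ?D \<partial>distr M (F s) (\<lambda>\<omega>. \<omega>))"
    unfolding pair[symmetric] by (rule D.nn_integral_fst[symmetric]) (rule \<Phi>')
  also have "\<dots> = (\<integral>\<^sup>+\<omega>. \<integral>\<^sup>+z. \<Phi> (\<omega>, z) \<partial>distr M borel ?D \<partial>M)"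
    using D.borel_measurable_nn_integral_fst[OF \<Phi>'] by (subst nn_integral_distr[OF id_meas]) simp_all
  finally show ?thesis unfolding distr_D .
qed

text \<open>The form needed for induction along a grid: the past enters through a factor
  \<open>Q\<close> and a current position \<open>Y\<close>, and one step averages \<open>g\<close>
  over a Gaussian displacement.\<close>

lemma nn_integral_step:
  assumes "0 \<le> u" "0 < \<delta>"
    and Q [measurable]: "Q \<in> borel_measurable (F u)"
    and Y [measurable]: "Y \<in> borel_measurable (F u)"
    and g [measurable]: "g \<in> borel_measurable borel"
  shows "(\<integral>\<^sup>+\<omega>. Q \<omega> * g (Y \<omega> + (W (u + \<delta>) \<omega> - W u \<omega>)) \<partial>M) =
         (\<integral>\<^sup>+\<omega>. Q \<omega> * (\<integral>\<^sup>+z. g (Y \<omega> + z) \<partial>density lborel (normal_density 0 (sqrt \<delta>))) \<partial>M)"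
proof -
  have meas: "(\<lambda>(\<omega>, z). Q \<omega> * g (Y \<omega> + z)) \<in> borel_measurable (F u \<Otimes>\<^sub>M borel)"
    by measurable
  have "(\<integral>\<^sup>+\<omega>. Q \<omega> * g (Y \<omega> + (W (u + \<delta>) \<omega> - W u \<omega>)) \<partial>M) =
      (\<integral>\<^sup>+\<omega>. \<integral>\<^sup>+z. Q \<omega> * g (Y \<omega> + z) \<partial>density lborel (normal_density 0 (sqrt \<delta>)) \<partial>M)"
    using nn_integral_increment[OF assms(1) _ meas, of "u + \<delta>"] assms(2) by simp
  also have "\<dots> = (\<integral>\<^sup>+\<omega>. Q \<omega> * (\<integral>\<^sup>+z. g (Y \<omega> + z) \<partial>density lborel (normal_density 0 (sqrt \<delta>))) \<partial>M)"
    by (intro nn_integral_cong nn_integral_cmult) simp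
  finally show ?thesis .
qed

end

text \<open>Integrating out the last increment turns the last two factors into one.\<close>

lemma (in brownian_motion) nn_integral_grid:
  fixes g :: "nat \<Rightarrow> real \<Rightarrow> ennreal"
  assumes "brownian_motion N B" "0 \<le> s" "0 < \<delta>" and A: "A \<in> sets (F s)"
    and g: "\<And>i. g i \<in> borel_measurable borel"
  shows "(\<integral>\<^sup>+\<omega>. indicator A \<omega> * (\<Prod>i\<le>m. g i (W (s + real i * \<delta>) \<omega> - W s \<omega>)) \<partial>M) =
         emeasure M A * (\<integral>\<^sup>+\<omega>. (\<Prod>i\<le>m. g i (B (real i * \<delta>) \<omega>)) \<partial>N)"
  using g
proof (induction m arbitrary: g)
  case 0
  interpret N: brownian_motion N B by fact
  \<comment> \<open>On \<open>M\<close> the zeroth argument is \<open>W s - W s\<close>, which is 0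
    everywhere; \<open>B\<close> starts at 0 only almost everywhere.\<close>
  have "(\<integral>\<^sup>+\<omega>. g 0 (B 0 \<omega>) \<partial>N) = (\<integral>\<^sup>+\<omega>. g 0 0 \<partial>N)"
    using N.AE_start by (intro nn_integral_cong_AE) auto
  then show ?case
    using sets_filtrationD[OF A] by (simp add: nn_integral_multc N.emeasure_space_1)
next
  case (Suc m)
  interpret N: brownian_motion N B by fact
  note [measurable] = Suc.prems
  define \<psi> where "\<psi> y = (\<integral>\<^sup>+z. g (Suc m) (y + z) \<partial>density lborel (normal_density 0 (sqrt \<delta>)))" for y
  interpret \<nu>: prob_space "density lborel (normal_density 0 (sqrt \<delta>))"
    using assms(3) by (intro prob_space_normal_density) auto
  have [measurable]: "\<psi> \<in> borel_measurable borel"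
    unfolding \<psi>_def by measurable
  \<comment> \<open>The averaged last factor depends only on the position at index \<open>m\<close>,
    so it is absorbed into that factor. This is why the induction is over arbitrary
    \<open>g\<close>.\<close>
  define h where "h = g(m := \<lambda>y. g m y * \<psi> y)"
  have h: "h i \<in> borel_measurable borel" for i
    by (auto simp: h_def)
  have prod_h: "(\<Prod>i\<le>m. h i (v i)) = (\<Prod>i\<le>m. g i (v i)) * \<psi> (v m)" for v
  proof (cases m)
    case (Suc k)
    have "(\<Prod>i\<le>k. h i (v i)) = (\<Prod>i\<le>k. g i (v i))"
      by (rule prod.cong) (auto simp: h_def Suc)
    then show ?thesis by (simp add: Suc h_def mult.assoc)
  qed (simp add: h_def)
  let ?V = "\<lambda>i \<omega>. W (s + real i * \<delta>) \<omega> - W s \<omega>"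
  let ?u = "s + real m * \<delta>"
  have V_meas: "?V i \<in> borel_measurable (F ?u)" if "i \<le> m" for i
    using that assms(2,3) by (intro borel_measurable_diff measurable_F) (auto intro: mult_right_mono)
  have A': "A \<in> sets (F ?u)"
    using assms(2,3) by (intro F_mono[OF _ A]) auto
  have "(\<integral>\<^sup>+\<omega>. indicator A \<omega> * (\<Prod>i\<le>Suc m. g i (?V i \<omega>)) \<partial>M) =
      (\<integral>\<^sup>+\<omega>. (indicator A \<omega> * (\<Prod>i\<le>m. g i (?V i \<omega>))) *
         g (Suc m) (?V m \<omega> + (W (?u + \<delta>) \<omega> - W ?u \<omega>)) \<partial>M)"
    by (intro nn_integral_cong) (simp add: algebra_simps)
  also have "\<dots> = (\<integral>\<^sup>+\<omega>. (indicator A \<omega> * (\<Prod>i\<le>m. g i (?V i \<omega>))) * \<psi> (?V m \<omega>) \<partial>M)"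
    unfolding \<psi>_def
    using assms(2,3) A' V_meas
    by (intro nn_integral_step borel_measurable_times_ennreal borel_measurable_prod_ennreal
          measurable_compose[OF _ Suc.prems] borel_measurable_indicator Suc.prems) auto
  also have "\<dots> = (\<integral>\<^sup>+\<omega>. indicator A \<omega> * (\<Prod>i\<le>m. h i (?V i \<omega>)) \<partial>M)"
    by (simp add: prod_h mult.assoc)
  also have "\<dots> = emeasure M A * (\<integral>\<^sup>+\<omega>. (\<Prod>i\<le>m. h i (B (real i * \<delta>) \<omega>)) \<partial>N)"
    by (rule Suc.IH) (rule h)
  also have "(\<integral>\<^sup>+\<omega>. (\<Prod>i\<le>m. h i (B (real i * \<delta>) \<omega>)) \<partial>N) =
      (\<integral>\<^sup>+\<omega>. (\<Prod>i\<le>m. g i (B (real i * \<delta>) \<omega>)) * \<psi> (B (real m * \<delta>) \<omega>) \<partial>N)"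
    by (simp add: prod_h)
  \<comment> \<open>The averaging is undone on the side of \<open>B\<close>: \<open>\<psi>\<close>
    depends on \<open>\<delta>\<close> alone, not on the process.\<close>
  also have "\<dots> = (\<integral>\<^sup>+\<omega>. (\<Prod>i\<le>m. g i (B (real i * \<delta>) \<omega>)) *
         g (Suc m) (B (real m * \<delta>) \<omega> + (B (real m * \<delta> + \<delta>) \<omega> - B (real m * \<delta>) \<omega>)) \<partial>N)"
    unfolding \<psi>_def using assms(3)
    by (intro N.nn_integral_step[symmetric] borel_measurable_prod_ennreal
          measurable_compose[OF _ Suc.prems] N.measurable_F Suc.prems)
       (auto intro: mult_right_mono)
  also have "\<dots> = (\<integral>\<^sup>+\<omega>. (\<Prod>i\<le>Suc m. g i (B (real i * \<delta>) \<omega>)) \<partial>N)"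
    by (intro nn_integral_cong) (simp add: algebra_simps)
  finally show ?case .
qed

section \<open>The Markov property for boundary crossing events\<close>

text \<open>Rounding \<open>r\<close> down to dyadic multiples of \<open>u\<close> gives grid points
  converging to \<open>r\<close>, and a weak inequality survives the limit.\<close>

lemma grid_dense:
  fixes g :: "real \<Rightarrow> real"
  assumes cont: "continuous_on {0..u} g" and r: "r \<in> {0..u}"
    and grid: "\<And>n i. i \<le> 2 ^ n \<Longrightarrow> g (real i * (u / 2 ^ n)) \<le> c"
  shows "g r \<le> c"
proof (cases "u = 0")
  case True
  then show ?thesis using r grid[of 0 0] by simp
next
  case False
  then have u: "0 < u" using r by auto
  define k where "k n = nat \<lfloor>r / u * 2 ^ n\<rfloor>" for n :: nat
  define \<rho> where "\<rho> n = real (k n) * (u / 2 ^ n)" for n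
  have floor: "real (k n) = of_int \<lfloor>r / u * 2 ^ n\<rfloor>" for n
    using r u by (simp add: k_def)
  have up: "\<rho> n \<le> r" for n
  proof -
    have "real (k n) \<le> r / u * 2 ^ n"
      unfolding floor by (rule of_int_floor_le)
    then show ?thesis using u by (simp add: \<rho>_def field_simps)
  qed
  have lo: "r - u / 2 ^ n \<le> \<rho> n" for n
  proof -
    have "r / u * 2 ^ n - 1 \<le> real (k n)"
      unfolding floor by linarith
    then have "(r / u * 2 ^ n - 1) * (u / 2 ^ n) \<le> \<rho> n"
      unfolding \<rho>_def using u by (intro mult_right_mono) auto
    then show ?thesis using u by (simp add: left_diff_distrib diff_divide_distrib)
  qed
  have "(\<lambda>n. r - u * (1 / 2) ^ n) \<longlonglongrightarrow> r - u * 0"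
    by (intro tendsto_intros LIMSEQ_power_zero) auto
  then have "(\<lambda>n. r - u / 2 ^ n) \<longlonglongrightarrow> r"
    by (simp add: power_divide)
  then have "\<rho> \<longlonglongrightarrow> r"
    by (rule tendsto_sandwich[rotated 2, OF _ tendsto_const]) (use up lo in auto)
  moreover have "\<rho> n \<in> {0..u}" for n
    using up[of n] r u by (auto simp: \<rho>_def)
  ultimately have "(\<lambda>n. g (\<rho> n)) \<longlonglongrightarrow> g r"
    by (intro continuous_on_tendsto_compose[OF cont _ r]) auto
  moreover have "k n \<le> 2 ^ n" for n
  proof -
    have "real (k n) \<le> 2 ^ n"
      unfolding floor using r u by (intro order_trans[OF of_int_floor_le]) (auto simp: field_simps)
    then show ?thesis by (metis of_nat_le_iff of_nat_numeral of_nat_power)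
  qed
  ultimately show ?thesis
    using grid by (intro tendsto_upperbound[of "\<lambda>n. g (\<rho> n)"]) (auto simp: \<rho>_def)
qed

lemma grid_point_in:
  fixes u :: real
  assumes "0 \<le> u" "i \<le> 2 ^ n"
  shows "real i * (u / 2 ^ n) \<in> {0..u}"
proof -
  have "real i \<le> 2 ^ n" using assms by (metis of_nat_le_iff of_nat_numeral of_nat_power)
  then have "real i * u \<le> 2 ^ n * u" using assms by (intro mult_right_mono)
  then show ?thesis using assms by (auto simp: field_simps)
qed

text \<open>The maximum over a compact interval is attained, so strict negativity leaves a uniform
  margin. With the margin the inequality may be weak, hence can be recovered from the dyadic points.
  An uncountable condition becomes a countable one.\<close>

lemma all_less_iff_grid:
  fixes g :: "real \<Rightarrow> real"
  assumes cont: "continuous_on {0..u} g" and u: "0 \<le> u"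
  shows "(\<forall>r\<in>{0..u}. g r < 0) \<longleftrightarrow>
         (\<exists>k. \<forall>n. \<forall>i\<in>{..2 ^ n}. g (real i * (u / 2 ^ n)) \<le> - 1 / real (Suc k))" (is "?L \<longleftrightarrow> ?R")
proof
  assume L: ?L
  obtain r0 where r0: "r0 \<in> {0..u}" "\<And>r. r \<in> {0..u} \<Longrightarrow> g r \<le> g r0"
    using continuous_attains_sup[of "{0..u}" g] cont u by auto
  obtain k where k: "inverse (real (Suc k)) < - g r0"
    using L r0 reals_Archimedean[of "- g r0"] by auto
  have "g (real i * (u / 2 ^ n)) \<le> - 1 / real (Suc k)" if "i \<le> 2 ^ n" for n i
  proof -
    have "real i * (u / 2 ^ n) \<in> {0..u}" using u that by (rule grid_point_in)
    then show ?thesis using r0(2) k by (fastforce simp: inverse_eq_divide)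
  qed
  then show ?R by blast
next
  assume ?R
  then obtain k where "\<And>n i. i \<le> 2 ^ n \<Longrightarrow> g (real i * (u / 2 ^ n)) \<le> - 1 / real (Suc k)"
    by blast
  from grid_dense[OF cont _ this] have "g r \<le> - 1 / real (Suc k)" if "r \<in> {0..u}" for r
    using that by blast
  moreover have "- 1 / real (Suc k) < 0" by simp
  ultimately show ?L by (meson le_less_trans)
qed

text \<open>Used mostly with \<open>S\<close> a member of the filtration: only values at times in
  \<open>{0..u}\<close> enter, so the event belongs to the past without completing it.\<close>

lemma sets_all_less:
  fixes Z :: "real \<Rightarrow> 'a \<Rightarrow> real"
  assumes u: "0 \<le> u" and Z: "\<And>r. r \<in> {0..u} \<Longrightarrow> Z r \<in> borel_measurable S"
    and cont: "\<And>\<omega>. \<omega> \<in> space S \<Longrightarrow> continuous_on {0..u} (\<lambda>r. Z r \<omega>)"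
  shows "{\<omega> \<in> space S. \<forall>r\<in>{0..u}. Z r \<omega> < 0} \<in> sets S"
proof -
  have "{\<omega> \<in> space S. \<forall>r\<in>{0..u}. Z r \<omega> < 0} =
      (\<Union>k. \<Inter>n. \<Inter>i\<in>{..2 ^ n}. {\<omega> \<in> space S. Z (real i * (u / 2 ^ n)) \<omega> \<le> - 1 / real (Suc k)})"
    using all_less_iff_grid[OF cont u] by (auto simp del: of_nat_Suc)
  also have "\<dots> \<in> sets S"
  proof -
    have "(\<Inter>i\<in>{..2 ^ n}. {\<omega> \<in> space S. Z (real i * (u / 2 ^ n)) \<omega> \<le> - 1 / real (Suc k)}) \<in> sets S" for k n
      using Z[OF grid_point_in[OF u]] by (intro sets.finite_INT borel_measurable_le borel_measurable_const) auto
    then show ?thesis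
      by (intro sets.countable_UN sets.countable_INT'[of UNIV] image_subsetI) auto
  qed
  finally show ?thesis .
qed

text \<open>The grid identity followed by two monotone limits: refining the dyadic grid shrinks the
  event, relaxing the margin \<open>1 / Suc k\<close> enlarges it. As \<open>B\<close> may live on
  another space or be a rescaled path, this is the Markov property together with uniqueness of the
  law.\<close>

lemma (in brownian_motion) markov_property:
  assumes BM: "brownian_motion N B" and s: "0 \<le> s" and u: "0 < u" and A: "A \<in> sets (F s)"
    and b: "continuous_on {0..u} b"
  shows "prob (A \<inter> {\<omega> \<in> space M. \<forall>r\<in>{0..u}. W (s + r) \<omega> - W s \<omega> < b r}) =
         prob A * measure N {\<omega> \<in> space N. \<forall>r\<in>{0..u}. B r \<omega> < b r}"
proof -
  interpret N: brownian_motion N B by fact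
  define p where "p n i = real i * (u / 2 ^ n)" for n i
  have p: "p n i \<in> {0..u}" if "i \<le> 2 ^ n" for n i
    unfolding p_def using u that by (intro grid_point_in) auto
  \<comment> \<open>Each grid is contained in the next one, which is what makes the events monotone
    in \<open>n\<close>.\<close>
  have p_Suc: "p n i = p (Suc n) (2 * i)" for n i
    by (simp add: p_def)
  define X where "X k n = A \<inter> {\<omega> \<in> space M. \<forall>i\<in>{..2 ^ n}. W (s + p n i) \<omega> - W s \<omega> - b (p n i) \<le> - 1 / real (Suc k)}"
    for k n
  define Y where "Y k n = {\<omega> \<in> space N. \<forall>i\<in>{..2 ^ n}. B (p n i) \<omega> - b (p n i) \<le> - 1 / real (Suc k)}" for k n
  have A': "A \<in> sets M" by (rule sets_filtrationD) (rule A)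
  have X_sets: "X k n \<in> sets M" for k n
    unfolding X_def using s p by (intro sets.Int A' sets.sets_Collect_finite_All finite_atMost
      borel_measurable_le borel_measurable_diff measurable_W borel_measurable_const) auto
  have Y_sets: "Y k n \<in> sets N" for k n
    unfolding Y_def using p by (intro sets.sets_Collect_finite_All finite_atMost
      borel_measurable_le borel_measurable_diff N.measurable_W borel_measurable_const) auto
  have grid: "prob (X k n) = prob A * measure N (Y k n)" for k n
  proof -
    \<comment> \<open>The margin is part of the threshold, so the product of these indicators is 1
      exactly when all grid conditions hold.\<close>
    define g where "g i = (indicator {..b (p n i) - 1 / real (Suc k)} :: real \<Rightarrow> ennreal)" for i
    have ind: "(\<Prod>i\<le>2 ^ n. g i (v i)) = indicator {v. \<forall>i\<in>{..2 ^ n}. v i - b (p n i) \<le> - 1 / real (Suc k)} v" for v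
    proof (cases "\<forall>i\<in>{..2 ^ n}. v i - b (p n i) \<le> - 1 / real (Suc k)")
      case True
      then have "(\<Prod>i\<le>2 ^ n. g i (v i)) = 1"
        by (intro prod.neutral) (auto simp: g_def indicator_def algebra_simps)
      then show ?thesis using True by (simp add: indicator_def)
    next
      case False
      then obtain i where "i \<le> 2 ^ n" "g i (v i) = 0"
        by (auto simp: g_def indicator_def algebra_simps)
      then have "(\<Prod>i\<le>2 ^ n. g i (v i)) = 0" by (auto simp: prod_zero_iff)
      then show ?thesis using False by (subst indicator_simps(2)) auto
    qed
    have "emeasure M (X k n) = (\<integral>\<^sup>+\<omega>. indicator (X k n) \<omega> \<partial>M)"
      using X_sets by simp
    also have "\<dots> = (\<integral>\<^sup>+\<omega>. indicator A \<omega> * (\<Prod>i\<le>2 ^ n. g i (W (s + real i * (u / 2 ^ n)) \<omega> - W s \<omega>)) \<partial>M)"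
      unfolding ind X_def p_def[symmetric]
      by (intro nn_integral_cong) (simp add: indicator_def del: of_nat_Suc)
    also have "\<dots> = emeasure M A * (\<integral>\<^sup>+\<omega>. (\<Prod>i\<le>2 ^ n. g i (B (real i * (u / 2 ^ n)) \<omega>)) \<partial>N)"
      using u by (intro nn_integral_grid BM s A) (auto simp: g_def)
    also have "(\<integral>\<^sup>+\<omega>. (\<Prod>i\<le>2 ^ n. g i (B (real i * (u / 2 ^ n)) \<omega>)) \<partial>N) = (\<integral>\<^sup>+\<omega>. indicator (Y k n) \<omega> \<partial>N)"
      unfolding ind Y_def p_def[symmetric]
      by (intro nn_integral_cong) (simp add: indicator_def del: of_nat_Suc)
    also have "\<dots> = emeasure N (Y k n)"
      using Y_sets by simp
    finally show ?thesis
      by (simp add: emeasure_eq_measure N.emeasure_eq_measure flip: ennreal_mult)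
  qed
  have decX: "decseq (X k)" for k
  proof (rule decseq_SucI)
    fix n
    have "2 * i \<in> {..2 ^ Suc n}" if "i \<in> {..2 ^ n}" for i :: nat
      using that by simp
    then show "X k (Suc n) \<subseteq> X k n"
      unfolding X_def p_Suc[of n] by blast
  qed
  have decY: "decseq (Y k)" for k
  proof (rule decseq_SucI)
    fix n
    have "2 * i \<in> {..2 ^ Suc n}" if "i \<in> {..2 ^ n}" for i :: nat
      using that by simp
    then show "Y k (Suc n) \<subseteq> Y k n"
      unfolding Y_def p_Suc[of n] by blast
  qed
  have mono: "- 1 / real (Suc k) \<le> - 1 / real (Suc (Suc k))" for k
    by (simp add: field_simps)
  have incX: "incseq (\<lambda>k. \<Inter>n. X k n)"
    unfolding X_def by (intro incseq_SucI) (blast intro: order_trans[OF _ mono])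
  have incY: "incseq (\<lambda>k. \<Inter>n. Y k n)"
    unfolding Y_def by (intro incseq_SucI) (blast intro: order_trans[OF _ mono])
  have lim: "prob (\<Inter>n. X k n) = prob A * measure N (\<Inter>n. Y k n)" for k
  proof (rule LIMSEQ_unique)
    show "(\<lambda>n. prob (X k n)) \<longlonglongrightarrow> prob (\<Inter>n. X k n)"
      using X_sets decX by (intro finite_Lim_measure_decseq) auto
    show "(\<lambda>n. prob (X k n)) \<longlonglongrightarrow> prob A * measure N (\<Inter>n. Y k n)"
      unfolding grid using Y_sets decY by (intro tendsto_mult tendsto_const N.finite_Lim_measure_decseq) auto
  qed
  have "prob (\<Union>k. \<Inter>n. X k n) = prob A * measure N (\<Union>k. \<Inter>n. Y k n)"
  proof (rule LIMSEQ_unique)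
    show "(\<lambda>k. prob (\<Inter>n. X k n)) \<longlonglongrightarrow> prob (\<Union>k. \<Inter>n. X k n)"
      using X_sets incX by (intro finite_Lim_measure_incseq) auto
    show "(\<lambda>k. prob (\<Inter>n. X k n)) \<longlonglongrightarrow> prob A * measure N (\<Union>k. \<Inter>n. Y k n)"
      unfolding lim using Y_sets incY by (intro tendsto_mult tendsto_const N.finite_Lim_measure_incseq) auto
  qed
  also have "(\<Union>k. \<Inter>n. X k n) = A \<inter> {\<omega> \<in> space M. \<forall>r\<in>{0..u}. W (s + r) \<omega> - W s \<omega> < b r}"
  proof -
    have "(\<forall>r\<in>{0..u}. W (s + r) \<omega> - W s \<omega> < b r) \<longleftrightarrow>
        (\<exists>k. \<forall>n. \<forall>i\<in>{..2 ^ n}. W (s + p n i) \<omega> - W s \<omega> - b (p n i) \<le> - 1 / real (Suc k))"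
      if "\<omega> \<in> space M" for \<omega>
    proof -
      have "continuous_on {0..u} (\<lambda>r. W (s + r) \<omega> - W s \<omega> - b r)"
        using s by (intro continuous_intros b continuous_on_compose2[OF continuous_path[OF that]]) auto
      from all_less_iff_grid[OF this] u show ?thesis by (simp add: p_def)
    qed
    then show ?thesis unfolding X_def by auto
  qed
  also have "(\<Union>k. \<Inter>n. Y k n) = {\<omega> \<in> space N. \<forall>r\<in>{0..u}. B r \<omega> < b r}"
  proof -
    have "(\<forall>r\<in>{0..u}. B r \<omega> < b r) \<longleftrightarrow>
        (\<exists>k. \<forall>n. \<forall>i\<in>{..2 ^ n}. B (p n i) \<omega> - b (p n i) \<le> - 1 / real (Suc k))"
      if "\<omega> \<in> space N" for \<omega>
    proof -
      have "continuous_on {0..u} (\<lambda>r. B r \<omega> - b r)"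
        by (intro continuous_intros b continuous_on_subset[OF N.continuous_path[OF that]]) auto
      from all_less_iff_grid[OF this] u show ?thesis by (simp add: p_def)
    qed
    then show ?thesis unfolding Y_def by auto
  qed
  finally show ?thesis .
qed

section \<open>Attained first hitting times and Brownian scaling\<close>

text \<open>Passes from infima in \<open>ennreal\<close>, as in the definitions of the random times,
  to real minima. The empty set, whose infimum there is \<open>\<infinity>\<close>, is kept
  apart.\<close>

lemma Inf_ennreal_image_closed:
  fixes S :: "real set"
  assumes "closed S" "S \<subseteq> {0..}" "S \<noteq> {}"
  shows "Inf S \<in> S" "Inf (ennreal ` S) = ennreal (Inf S)"
proof -
  have bdd: "bdd_below S" using assms(2) by (intro bdd_belowI[of _ 0]) auto
  show mem: "Inf S \<in> S" by (rule closed_contains_Inf) (use assms bdd in auto)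
  show "Inf (ennreal ` S) = ennreal (Inf S)"
  proof (rule antisym)
    show "Inf (ennreal ` S) \<le> ennreal (Inf S)" using mem by (intro Inf_lower) auto
    show "ennreal (Inf S) \<le> Inf (ennreal ` S)"
      using bdd by (intro Inf_greatest) (auto intro!: ennreal_leI cInf_lower)
  qed
qed

lemma hitting_time_attained:
  assumes cont: "continuous_on {0..} (\<lambda>t. W t \<omega>)" and t: "0 \<le> t" "W t \<omega> = \<xi>"
  obtains \<sigma> where "0 \<le> \<sigma>" "\<sigma> \<le> t" "hitting_time W \<xi> \<omega> = ennreal \<sigma>" "W \<sigma> \<omega> = \<xi>"
    "\<And>s. 0 \<le> s \<Longrightarrow> W s \<omega> = \<xi> \<Longrightarrow> \<sigma> \<le> s"
proof -
  define S where "S = {t. 0 \<le> t \<and> W t \<omega> = \<xi>}"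
  have "S = {0..} \<inter> (\<lambda>t. W t \<omega>) -` {\<xi>}" by (auto simp: S_def)
  then have S: "closed S"
    using continuous_closed_preimage[OF cont, of "{\<xi>}"] by simp
  have ne: "S \<noteq> {}" "S \<subseteq> {0..}" using t by (auto simp: S_def)
  have bdd: "bdd_below S" by (intro bdd_belowI[of _ 0]) (auto simp: S_def)
  have "hitting_time W \<xi> \<omega> = Inf (ennreal ` S)"
    unfolding hitting_time_def S_def by (rule arg_cong[where f = Inf]) auto
  then have "hitting_time W \<xi> \<omega> = ennreal (Inf S)"
    using Inf_ennreal_image_closed[OF S] ne by simp
  moreover have "Inf S \<in> S" using Inf_ennreal_image_closed[OF S] ne by simp
  moreover have "Inf S \<le> s" if "0 \<le> s" "W s \<omega> = \<xi>" for s
    using bdd that by (intro cInf_lower) (auto simp: S_def)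
  ultimately show ?thesis using that t by (auto simp: S_def)
qed

text \<open>Time \<open>s\<close> of the rescaled path is time \<open>s / c\<^sup>2\<close> of
  \<open>W\<close>, so its past lies in \<open>F (s / c\<^sup>2)\<close> and independence is
  inherited. Together with the Markov property this reduces events on any scale to unit
  scale.\<close>

lemma (in brownian_motion) brownian_scaling:
  assumes c: "0 < c"
  shows "brownian_motion M (\<lambda>t \<omega>. c * W (t / c\<^sup>2) \<omega>)"
proof -
  let ?V = "\<lambda>t \<omega>. c * W (t / c\<^sup>2) \<omega>"
  have filt: "sets (natural_filtration M ?V (ennreal s)) \<subseteq> sets (F (s / c\<^sup>2))" if "0 \<le> s" for s
  proof -
    have "?V r -` A \<inter> space M \<in> sets (F (s / c\<^sup>2))"
      if "0 \<le> r" "ennreal r \<le> ennreal s" "A \<in> sets borel" for r A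
    proof -
      have "?V r \<in> borel_measurable (F (s / c\<^sup>2))"
        using that \<open>0 \<le> s\<close> by (intro borel_measurable_times borel_measurable_const measurable_F)
          (auto simp: divide_right_mono)
      from measurable_sets[OF this \<open>A \<in> sets borel\<close>] show ?thesis by simp
    qed
    then have "{?V r -` A \<inter> space M |r A. 0 \<le> r \<and> ennreal r \<le> ennreal s \<and> A \<in> sets borel} \<subseteq> sets (F (s / c\<^sup>2))"
      by blast
    from sets.sigma_sets_subset[OF this] show ?thesis
      unfolding sets_natural_filtration[of M ?V] by simp
  qed
  have distr: "distributed M lborel (\<lambda>\<omega>. ?V t \<omega> - ?V s \<omega>) (normal_density 0 (sqrt (t - s)))"
    if "0 \<le> s" "s < t" for s t
  proof -
    have "distributed M lborel (\<lambda>\<omega>. 0 + c * (W (t / c\<^sup>2) \<omega> - W (s / c\<^sup>2) \<omega>))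
        (normal_density (0 + c * 0) (\<bar>c\<bar> * sqrt (t / c\<^sup>2 - s / c\<^sup>2)))"
      using c that by (intro normal_density_affine increment_normal)
        (auto simp: divide_strict_right_mono)
    moreover have "\<bar>c\<bar> * sqrt (t / c\<^sup>2 - s / c\<^sup>2) = sqrt (t - s)"
      using c by (simp add: diff_divide_distrib[symmetric] real_sqrt_divide)
    ultimately show ?thesis by (simp add: right_diff_distrib)
  qed
  have indep: "indep_set (sets (natural_filtration M ?V (ennreal s)))
      (sets (vimage_algebra (space M) (\<lambda>\<omega>. ?V t \<omega> - ?V s \<omega>) borel))" if st: "0 \<le> s" "s < t" for s t
  proof (rule indep_setI)
    have [measurable]: "(\<lambda>\<omega>. ?V t \<omega> - ?V s \<omega>) \<in> borel_measurable M"
      using st by (intro borel_measurable_diff borel_measurable_times borel_measurable_const measurable_W) auto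
    show "sets (natural_filtration M ?V (ennreal s)) \<subseteq> events"
      using filt[OF st(1)] sets_filtration_subset by blast
    show "sets (vimage_algebra (space M) (\<lambda>\<omega>. ?V t \<omega> - ?V s \<omega>) borel) \<subseteq> events"
      by (auto simp: sets_vimage_algebra2)
    fix A C assume A: "A \<in> sets (natural_filtration M ?V (ennreal s))"
      and "C \<in> sets (vimage_algebra (space M) (\<lambda>\<omega>. ?V t \<omega> - ?V s \<omega>) borel)"
    then obtain C' where C': "C' \<in> sets borel" "C = (\<lambda>\<omega>. ?V t \<omega> - ?V s \<omega>) -` C' \<inter> space M"
      by (auto simp: sets_vimage_algebra2)
    have "(*) c -` C' \<inter> space borel \<in> sets borel"
      by (rule measurable_sets[OF _ C'(1)]) simp
    then have *: "(*) c -` C' \<in> sets borel" by simp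
    have eq: "C = {\<omega> \<in> space M. W (t / c\<^sup>2) \<omega> - W (s / c\<^sup>2) \<omega> \<in> (*) c -` C'}"
      unfolding C' by (auto simp: right_diff_distrib)
    show "prob (A \<inter> C) = prob A * prob C"
      unfolding eq using st c filt[OF st(1)] A *
      by (intro increment_indep) (auto simp: divide_strict_right_mono)
  qed
  have cont: "continuous_on {0..} (\<lambda>t. ?V t \<omega>)" if "\<omega> \<in> space M" for \<omega>
    using c by (intro continuous_intros continuous_on_compose2[OF continuous_path[OF that]]) auto
  have "standard_brownian_motion M ?V"
    unfolding standard_brownian_motion_def
    using prob_space_axioms AE_start cont distr indep by auto
  then show ?thesis by unfold_locales
qed

section \<open>Gaussian increments and bounds on the running maximum\<close>

context brownian_motion
begin

lemma increment_interval_pos: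
  assumes "0 \<le> s" "s < t" "c < d"
  shows "0 < prob {\<omega> \<in> space M. W t \<omega> - W s \<omega> \<in> {c..d}}"
proof (rule ccontr)
  let ?f = "\<lambda>y. ennreal (normal_density 0 (sqrt (t - s)) y)"
  assume "\<not> ?thesis"
  then have "prob {\<omega> \<in> space M. W t \<omega> - W s \<omega> \<in> {c..d}} = 0"
    using measure_nonneg[of M] by (metis less_eq_real_def)
  then have "emeasure M ((\<lambda>\<omega>. W t \<omega> - W s \<omega>) -` {c..d} \<inter> space M) = 0"
    by (simp add: emeasure_eq_measure vimage_def Int_def conj_commute)
  then have "(\<integral>\<^sup>+y. ?f y * indicator {c..d} y \<partial>lborel) = 0"
    using distributed_emeasure[OF increment_normal[OF assms(1,2)], of "{c..d}"] by simp
  then have "AE y in lborel. ?f y * indicator {c..d} y = 0"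
    by (subst (asm) nn_integral_0_iff_AE) auto
  then have "AE y in lborel. y \<notin> {c..d}"
  proof (elim eventually_mono)
    fix y assume "?f y * indicator {c..d} y = 0"
    moreover have "?f y \<noteq> 0"
      using normal_density_pos[of "sqrt (t - s)" 0 y] assms(2) by (simp add: ennreal_eq_0_iff)
    ultimately show "y \<notin> {c..d}" by (auto simp: indicator_def)
  qed
  then have "emeasure lborel {c..d} = 0"
    by (subst (asm) AE_iff_measurable[of "{c..d}"]) auto
  then show False using assms(3) by simp
qed

lemma prob_increment_less:
  assumes "0 \<le> s" "s < t"
  shows "prob {\<omega> \<in> space M. W t \<omega> - W s \<omega> < c * sqrt (t - s)} = prob {\<omega> \<in> space M. W 1 \<omega> - W 0 \<omega> < c}"
proof -
  have "prob {\<omega> \<in> space M. W t \<omega> - W s \<omega> < c * sqrt (t - s)} = measure (density lborel std_normal_density) {..<c}"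
    if "0 \<le> s" "s < t" for s t
  proof -
    let ?D = "\<lambda>\<omega>. (W t \<omega> - W s \<omega> - 0) / sqrt (t - s)"
    have D: "distributed M lborel ?D std_normal_density"
      using increment_normal[OF that] that by (subst (asm) normal_standard_normal_convert) auto
    have "measure (density lborel std_normal_density) {..<c} = measure (distr M lborel ?D) {..<c}"
      using distributed_distr_eq_density[OF D] by simp
    also have "\<dots> = prob (?D -` {..<c} \<inter> space M)"
      using distributed_measurable[OF D] by (subst measure_distr) auto
    also have "?D -` {..<c} \<inter> space M = {\<omega> \<in> space M. W t \<omega> - W s \<omega> < c * sqrt (t - s)}"
      using that by (auto simp: field_simps)
    finally show ?thesis ..
  qed
  from this[OF assms] this[of 0 1] show ?thesis by simp
qed

lemma sets_path_below:
  assumes "0 \<le> s" "0 \<le> u" "s + u \<le> t" "continuous_on {0..u} b"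
  shows "{\<omega> \<in> space M. \<forall>r\<in>{0..u}. W (s + r) \<omega> - W s \<omega> < b r} \<in> sets (F t)"
    "{\<omega> \<in> space M. \<forall>r\<in>{0..u}. W r \<omega> < b r} \<in> sets (F t)"
proof -
  have "{\<omega> \<in> space (F t). \<forall>r\<in>{0..u}. W (s + r) \<omega> - W s \<omega> - b r < 0} \<in> sets (F t)"
    using assms by (intro sets_all_less borel_measurable_diff borel_measurable_const measurable_F
      continuous_intros continuous_on_compose2[OF continuous_path]) auto
  then show "{\<omega> \<in> space M. \<forall>r\<in>{0..u}. W (s + r) \<omega> - W s \<omega> < b r} \<in> sets (F t)" by simp
  have "{\<omega> \<in> space (F t). \<forall>r\<in>{0..u}. W r \<omega> - b r < 0} \<in> sets (F t)"
    using assms by (intro sets_all_less borel_measurable_diff borel_measurable_const measurable_F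
      continuous_intros continuous_on_subset[OF continuous_path]) auto
  then show "{\<omega> \<in> space M. \<forall>r\<in>{0..u}. W r \<omega> < b r} \<in> sets (F t)" by simp
qed

text \<open>Continuous paths are bounded on compact intervals, so the events for growing levels
  exhaust the space.\<close>

lemma path_bounded_high_prob:
  assumes "0 \<le> u" "q < 1"
  shows "\<exists>L>0. \<forall>L'\<ge>L. q < prob {\<omega> \<in> space M. \<forall>r\<in>{0..u}. W r \<omega> < L'}"
proof -
  let ?E = "\<lambda>L. {\<omega> \<in> space M. \<forall>r\<in>{0..u}. W r \<omega> < L}"
  have sets: "?E L \<in> sets M" for L
    using sets_path_below(2)[of 0 u u "\<lambda>_. L"] assms by (auto intro: sets_filtrationD)
  have "(\<Union>n. ?E (real n)) = space M"
  proof safe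
    fix \<omega> assume \<omega>: "\<omega> \<in> space M"
    have "compact ((\<lambda>r. W r \<omega>) ` {0..u})"
      by (intro compact_continuous_image continuous_on_subset[OF continuous_path[OF \<omega>]]) auto
    then have "bdd_above ((\<lambda>r. W r \<omega>) ` {0..u})"
      by (intro bounded_imp_bdd_above compact_imp_bounded)
    then obtain C where C: "\<And>r. r \<in> {0..u} \<Longrightarrow> W r \<omega> \<le> C"
      unfolding bdd_above_def by (meson imageI)
    obtain n where "C < real n" using reals_Archimedean2 by blast
    then show "\<omega> \<in> (\<Union>n. ?E (real n))" using \<omega> le_less_trans[OF C] by (auto intro!: exI[of _ n])
  qed
  moreover have "incseq (\<lambda>n. ?E (real n))"
    by (intro incseq_SucI) (auto intro: less_trans)
  ultimately have "(\<lambda>n. prob (?E (real n))) \<longlonglongrightarrow> 1"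
    using finite_Lim_measure_incseq[of "\<lambda>n. ?E (real n)"] sets prob_space by auto
  from order_tendstoD(1)[OF this assms(2)] obtain n0 where n0: "\<And>n. n \<ge> n0 \<Longrightarrow> q < prob (?E (real n))"
    unfolding eventually_sequentially by blast
  define n where "n = Suc n0"
  have "n > 0" "q < prob (?E (real n))" using n0[of n] by (auto simp: n_def)
  moreover have "prob (?E (real n)) \<le> prob (?E L')" if "real n \<le> L'" for L'
    using sets that by (intro finite_measure_mono) (auto intro: less_le_trans)
  ultimately show ?thesis by (intro exI[of _ "real n"]) (auto intro: less_le_trans)
qed

end

section \<open>Square root boundaries\<close>

context brownian_motion
begin

text \<open>Geometric grid \<open>4^k - 1\<close>: below half the boundary at one grid point, the path stays below the
  boundary and ends below half of it at the next grid point as soon as its running maximum is small on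
  the scale of the step. The probability of that is the same in every step and tends to 1 as \<open>a\<close> grows.\<close>

lemma sqrt_boundary_tail:
  assumes b: "0 < b"
  shows "\<exists>a0>0. \<forall>a\<ge>a0. \<exists>c>0. \<forall>u\<ge>0.
    c * (u + 1) powr - b \<le> prob {\<omega> \<in> space M. \<forall>r\<in>{0..u}. W r \<omega> < a * sqrt (r + 1)}"
proof -
  \<comment> \<open>Losing a factor \<open>q\<close> per step gives
    \<open>q ^ k = (4 ^ k) powr - b\<close>, which is the desired exponent at time
    \<open>4 ^ k\<close>.\<close>
  define q where "q = (4::real) powr - b"
  have q: "0 < q" "q < 1"
    using b powr_less_mono[of "- b" 0 4] by (auto simp: q_def)
  obtain L where L: "0 < L" "\<And>L'. L' \<ge> L \<Longrightarrow> q < prob {\<omega> \<in> space M. \<forall>r\<in>{0..3}. W r \<omega> < L'}"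
    using path_bounded_high_prob[of 3 q] q by auto
  have "\<exists>c>0. \<forall>u\<ge>0. c * (u + 1) powr - b \<le> prob {\<omega> \<in> space M. \<forall>r\<in>{0..u}. W r \<omega> < a * sqrt (r + 1)}"
    \<comment> \<open>On the scale of a step the permitted rise is \<open>a / 2\<close>, and this
      has to reach \<open>L\<close>.\<close>
    if a: "2 * L \<le> a" for a
  proof -
    have a0: "0 < a" using a L by simp
    define s where "s k = (4::real) ^ k - 1" for k :: nat
    have s0: "0 \<le> s k" for k by (simp add: s_def)
    have root: "sqrt (s k + 1) = 2 ^ k" for k
      by (simp add: s_def real_sqrt_power)
    have bdry: "continuous_on {0..u} (\<lambda>r. a * sqrt (r + 1))" for u
      by (intro continuous_intros)
    define G where "G k = {\<omega> \<in> space M. \<forall>r\<in>{0..s k}. W r \<omega> < a * sqrt (r + 1)} \<inter>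
        {\<omega> \<in> space M. W (s k) \<omega> \<le> a / 2 * 2 ^ k}" for k
    have G_F: "G k \<in> sets (F (s k))" for k
    proof -
      have "{\<omega> \<in> space (F (s k)). W (s k) \<omega> \<le> a / 2 * 2 ^ k} \<in> sets (F (s k))"
        using s0 by (intro borel_measurable_le measurable_F) auto
      then show ?thesis
        unfolding G_def using sets_path_below(2)[of 0 "s k" "s k"] s0 bdry by auto
    qed
    have step: "q * prob (G k) \<le> prob (G (Suc k))" for k
    proof -
      let ?c = "(2::real) ^ k"
      \<comment> \<open>From \<open>4 ^ k - 1\<close> to \<open>4 ^ Suc k - 1\<close> the time
        difference is \<open>3 * 4 ^ k\<close>; scaling space by \<open>2 ^ k\<close> turns it into
        3.\<close>
      let ?E = "{\<omega> \<in> space M. \<forall>r\<in>{0..3 * 4 ^ k}. W (s k + r) \<omega> - W (s k) \<omega> < a / 2 * ?c}"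
      have sq: "?c\<^sup>2 = 4 ^ k" by (simp add: power2_eq_square power_mult_distrib[symmetric])
      have "prob (G k \<inter> ?E) =
          prob (G k) * prob {\<omega> \<in> space M. \<forall>r\<in>{0..3 * 4 ^ k}. ?c * W (r / ?c\<^sup>2) \<omega> < a / 2 * ?c}"
        by (rule markov_property[OF brownian_scaling]) (use s0 G_F in auto)
      also have "{\<omega> \<in> space M. \<forall>r\<in>{0..3 * 4 ^ k}. ?c * W (r / ?c\<^sup>2) \<omega> < a / 2 * ?c} =
          {\<omega> \<in> space M. \<forall>r\<in>{0..3}. W r \<omega> < a / 2}"
      proof -
        have "(\<forall>r\<in>{0..3 * 4 ^ k}. ?c * W (r / ?c\<^sup>2) \<omega> < a / 2 * ?c) \<longleftrightarrow> (\<forall>r\<in>{0..3}. W r \<omega> < a / 2)" for \<omega>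
        proof safe
          fix r :: real assume *: "\<forall>r\<in>{0..3 * 4 ^ k}. ?c * W (r / ?c\<^sup>2) \<omega> < a / 2 * ?c" and r: "r \<in> {0..3}"
          have "?c * W (r * 4 ^ k / ?c\<^sup>2) \<omega> < a / 2 * ?c" using *[rule_format, of "r * 4 ^ k"] r by auto
          then show "W r \<omega> < a / 2" by (simp add: sq mult.commute[of ?c])
        next
          fix r :: real assume *: "\<forall>r\<in>{0..3}. W r \<omega> < a / 2" and r: "r \<in> {0..3 * 4 ^ k}"
          have "W (r / 4 ^ k) \<omega> < a / 2" using r by (intro *[rule_format]) (auto simp: field_simps)
          then show "?c * W (r / ?c\<^sup>2) \<omega> < a / 2 * ?c" by (simp add: sq mult.commute[of ?c])
        qed
        then show ?thesis by simp
      qed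
      finally have eq: "prob (G k \<inter> ?E) = prob (G k) * prob {\<omega> \<in> space M. \<forall>r\<in>{0..3}. W r \<omega> < a / 2}" .
      have "q * prob (G k) \<le> prob (G k \<inter> ?E)"
        unfolding eq using L(2)[of "a / 2"] a by (subst mult.commute) (intro mult_left_mono, auto)
      also have "\<dots> \<le> prob (G (Suc k))"
      proof (rule finite_measure_mono)
        show "G (Suc k) \<in> events" using G_F by (rule sets_filtrationD)
        show "G k \<inter> ?E \<subseteq> G (Suc k)"
        proof
          fix \<omega> assume \<omega>: "\<omega> \<in> G k \<inter> ?E"
          \<comment> \<open>The level \<open>a * 2 ^ k\<close> is the whole boundary at the
            beginning of the step and half of it at the end, so both requirements of
            \<open>G (Suc k)\<close> follow from this one bound.\<close>
          have late: "W r \<omega> < a * ?c" if "s k \<le> r" "r \<le> s (Suc k)" for r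
          proof -
            have "W (s k + (r - s k)) \<omega> - W (s k) \<omega> < a / 2 * ?c"
              using \<omega> that by (intro \<omega>[THEN IntD2, THEN CollectD, THEN conjunct2, rule_format]) (auto simp: s_def)
            moreover have "W (s k) \<omega> \<le> a / 2 * ?c" using \<omega> by (auto simp: G_def)
            ultimately show ?thesis by simp
          qed
          have "W r \<omega> < a * sqrt (r + 1)" if r: "0 \<le> r" "r \<le> s (Suc k)" for r
          proof (cases "r \<le> s k")
            case True then show ?thesis using \<omega> r by (auto simp: G_def)
          next
            case False
            then have "W r \<omega> < a * sqrt (s k + 1)" using late r root by simp
            also have "\<dots> \<le> a * sqrt (r + 1)" using False a0 by (intro mult_left_mono) auto
            finally show ?thesis .
          qed
          moreover have "W (s (Suc k)) \<omega> \<le> a / 2 * 2 ^ Suc k"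
            using late[of "s (Suc k)"] by (simp add: s_def)
          ultimately show "\<omega> \<in> G (Suc k)" using \<omega> by (auto simp: G_def)
        qed
      qed
      finally show ?thesis .
    qed
    have G0: "prob (G 0) = 1"
    proof (subst prob_eq_1)
      show "G 0 \<in> events" using G_F by (rule sets_filtrationD)
      show "AE \<omega> in M. \<omega> \<in> G 0"
        using AE_start AE_space by eventually_elim (use a0 in \<open>auto simp: G_def s_def\<close>)
    qed
    have pow: "q ^ k \<le> prob (G k)" for k
    proof (induction k)
      case (Suc k)
      have "q ^ Suc k \<le> q * prob (G k)" using Suc q by simp
      also have "\<dots> \<le> prob (G (Suc k))" by (rule step)
      finally show ?case .
    qed (simp add: G0)
    show ?thesis
    proof (intro exI[of _ q] conjI allI impI q)
      fix u :: real assume u: "0 \<le> u"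
      obtain j :: nat where "u + 1 < 4 ^ j" using real_arch_pow[of 4 "u + 1"] by auto
      then have ex: "\<exists>k. u + 1 \<le> 4 ^ k" by (auto intro: less_imp_le)
      \<comment> \<open>Rounding \<open>u + 1\<close> up to a power of 4 costs at most a factor 4,
        whence the constant \<open>q = 4 powr - b\<close> in the final bound.\<close>
      define k where "k = (LEAST k. u + 1 \<le> (4::real) ^ k)"
      have k: "u + 1 \<le> 4 ^ k" unfolding k_def using ex by (rule LeastI_ex)
      have k': "4 ^ k \<le> 4 * (u + 1)"
      proof (cases k)
        case (Suc i)
        then have "\<not> u + 1 \<le> 4 ^ i" using not_less_Least[of i "\<lambda>k. u + 1 \<le> (4::real) ^ k"] by (simp add: k_def)
        then show ?thesis using Suc by simp
      qed (use u in simp)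
      have "q * (u + 1) powr - b = (4 * (u + 1)) powr - b"
        unfolding q_def using u by (subst powr_mult) auto
      also have "\<dots> \<le> (4 ^ k) powr - b"
        using k' b by (intro powr_mono2') auto
      also have "\<dots> = q ^ k"
        by (simp add: q_def powr_powr powr_realpow[symmetric] mult.commute)
      also have "\<dots> \<le> prob (G k)" by (rule pow)
      also have "\<dots> \<le> prob {\<omega> \<in> space M. \<forall>r\<in>{0..u}. W r \<omega> < a * sqrt (r + 1)}"
        using sets_path_below(2)[of 0 u u "\<lambda>r. a * sqrt (r + 1)"] u bdry k
        by (intro finite_measure_mono) (auto simp: G_def s_def intro: sets_filtrationD)
      finally show "q * (u + 1) powr - b \<le> prob {\<omega> \<in> space M. \<forall>r\<in>{0..u}. W r \<omega> < a * sqrt (r + 1)}" .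
    qed
  qed
  then show ?thesis using L(1) by (intro exI[of _ "2 * L"]) auto
qed

text \<open>Fix \<open>m\<close>. Still being below the boundary at a much later time
  \<open>j\<close> forces either a very low position at \<open>m\<close>, which becomes improbable
  as \<open>j\<close> grows, or an increment below \<open>4 * a\<close> standard deviations. The
  latter is independent of the past and has the same probability \<open>q < 1\<close> for every
  \<open>j\<close>. Letting first \<open>j\<close> and then \<open>m\<close> tend to infinity yields
  \<open>prob C \<le> prob C * q\<close>.\<close>

lemma sqrt_boundary_crossed:
  fixes K :: nat
  assumes a: "0 < a"
  shows "prob {\<omega> \<in> space M. \<forall>k\<ge>K. x + W (real k) \<omega> < a * sqrt (real k + 1)} = 0"
proof -
  define H where "H m = {\<omega> \<in> space M. \<forall>k\<in>{K..m}. x + W (real k) \<omega> < a * sqrt (real k + 1)}" for m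
  define C where "C = {\<omega> \<in> space M. \<forall>k\<ge>K. x + W (real k) \<omega> < a * sqrt (real k + 1)}"
  define q where "q = prob {\<omega> \<in> space M. W 1 \<omega> - W 0 \<omega> < 4 * a}"
  have H_F: "H m \<in> sets (F (real m))" for m
  proof -
    have "{\<omega> \<in> space (F (real m)). \<forall>k\<in>{K..m}. x + W (real k) \<omega> < a * sqrt (real k + 1)} \<in> sets (F (real m))"
      by (intro sets.sets_Collect_finite_All borel_measurable_less borel_measurable_add
          borel_measurable_const measurable_F) auto
    then show ?thesis by (simp add: H_def)
  qed
  then have H_sets: "H m \<in> sets M" for m by (rule sets_filtrationD)
  have C_H: "C = (\<Inter>m. H m)"
  proof (intro equalityI subsetI)
    fix \<omega> assume \<omega>: "\<omega> \<in> (\<Inter>m. H m)"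
    then have "x + W (real k) \<omega> < a * sqrt (real k + 1)" if "K \<le> k" for k
      using INT_D[OF \<omega>, of k] that by (simp add: H_def)
    then show "\<omega> \<in> C" using INT_D[OF \<omega>, of 0] by (simp add: C_def H_def)
  qed (simp add: C_def H_def)
  have lim: "(\<lambda>m. prob (H m)) \<longlonglongrightarrow> prob C"
    unfolding C_H using H_sets by (intro finite_Lim_measure_decseq decseq_SucI) (auto simp: H_def)
  have C_sets: "C \<in> sets M"
    unfolding C_H using H_sets by (intro sets.countable_INT'[of UNIV]) auto
  have q: "q < 1"
  proof -
    have "0 < prob {\<omega> \<in> space M. W 1 \<omega> - W 0 \<omega> \<in> {4 * a..4 * a + 1}}"
      by (rule increment_interval_pos) auto
    also have "\<dots> \<le> prob (space M - {\<omega> \<in> space M. W 1 \<omega> - W 0 \<omega> < 4 * a})"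
      by (intro finite_measure_mono) auto
    also have "\<dots> = 1 - q"
      unfolding q_def by (intro prob_compl) measurable
    finally show ?thesis by simp
  qed
  have "prob C \<le> prob (H m) * q" for m
  proof -
    let ?T = "\<lambda>j. {\<omega> \<in> space M. x + W (real m) \<omega> < - (a * sqrt (real j + 1))}"
    have T_sets: "?T j \<in> sets M" for j by measurable
    \<comment> \<open>For such \<open>j\<close> the condition in \<open>C\<close> applies at time
      \<open>j\<close>, and \<open>j + 1 \<le> 4 * (j - m)\<close>; this is where the factor 4 in
      the definition of \<open>q\<close> comes from.\<close>
    have bound: "prob C \<le> prob (H m) * q + prob (?T j)" if j: "j \<ge> 2 * m + K + 1" for j
    proof -
      let ?D = "{\<omega> \<in> space M. W (real j) \<omega> - W (real m) \<omega> \<in> {..<4 * a * sqrt (real j - real m)}}"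
      have D_sets: "?D \<in> sets M" by measurable
      have rt: "2 * a * sqrt (real j + 1) \<le> 4 * a * sqrt (real j - real m)"
      proof -
        have "sqrt (real j + 1) \<le> sqrt (4 * (real j - real m))"
          using j by (intro real_sqrt_le_mono) auto
        also have "\<dots> = 2 * sqrt (real j - real m)"
          unfolding real_sqrt_mult by simp
        finally have "2 * a * sqrt (real j + 1) \<le> 2 * a * (2 * sqrt (real j - real m))"
          using a by (intro mult_left_mono) auto
        then show ?thesis by simp
      qed
      have "C \<subseteq> (H m \<inter> ?D) \<union> ?T j"
      proof
        fix \<omega> assume \<omega>: "\<omega> \<in> C"
        then have "x + W (real j) \<omega> < a * sqrt (real j + 1)" using j by (auto simp: C_def)
        then have "W (real j) \<omega> - W (real m) \<omega> < 4 * a * sqrt (real j - real m)"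
          if "\<not> x + W (real m) \<omega> < - (a * sqrt (real j + 1))" using that rt by simp
        then show "\<omega> \<in> (H m \<inter> ?D) \<union> ?T j" using \<omega> C_H by (auto simp: C_def)
      qed
      then have "prob C \<le> prob ((H m \<inter> ?D) \<union> ?T j)"
        using H_sets D_sets T_sets by (intro finite_measure_mono) auto
      also have "\<dots> \<le> prob (H m \<inter> ?D) + prob (?T j)"
        using H_sets D_sets T_sets by (intro measure_Un_le) auto
      also have "prob (H m \<inter> ?D) = prob (H m) * prob ?D"
        using j H_F by (intro increment_indep) auto
      also have "prob ?D = q"
        unfolding q_def using prob_increment_less[of "real m" "real j" "4 * a"] j by simp
      finally show ?thesis .
    qed
    have "(\<lambda>j. prob (?T j)) \<longlonglongrightarrow> prob (\<Inter>j. ?T j)"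
    proof (intro finite_Lim_measure_decseq decseq_SucI subsetI)
      fix j \<omega> assume "\<omega> \<in> ?T (Suc j)"
      moreover have "a * sqrt (real j + 1) \<le> a * sqrt (real (Suc j) + 1)"
        using a by (intro mult_left_mono) auto
      ultimately show "\<omega> \<in> ?T j" by auto
    qed (use T_sets in auto)
    also have "(\<Inter>j. ?T j) = {}"
    proof safe
      fix \<omega> assume \<omega>: "\<omega> \<in> (\<Inter>j. ?T j)"
      obtain j where j: "(\<bar>x + W (real m) \<omega>\<bar> / a)\<^sup>2 < real j" using reals_Archimedean2 by blast
      then have "\<bar>x + W (real m) \<omega>\<bar> / a \<le> sqrt (real j + 1)"
        using a by (intro real_le_rsqrt) auto
      moreover have "x + W (real m) \<omega> < - (a * sqrt (real j + 1))" using \<omega> by auto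
      ultimately show "\<omega> \<in> {}" using a by (auto simp: field_simps)
    qed
    finally have "(\<lambda>j. prob (H m) * q + prob (?T j)) \<longlonglongrightarrow> prob (H m) * q + 0"
      by (intro tendsto_intros) simp
    then show ?thesis
      using bound by (intro LIMSEQ_le_const) auto
  qed
  then have "prob C \<le> prob C * q"
    using lim by (intro LIMSEQ_le_const[OF tendsto_mult_right[OF lim]]) auto
  then have "prob C * (1 - q) \<le> 0" by (simp add: algebra_simps)
  then have "prob C \<le> 0" using q by (simp add: mult_le_0_iff)
  then have "prob C = 0" using measure_nonneg[of M C] by linarith
  then show ?thesis by (simp add: C_def)
qed

end

section \<open>Reaching zero and surviving up to a fixed time\<close>

context brownian_motion
begin

text \<open>An excursion up by \<open>l\<close> and then down by \<open>l\<close>, under a ceiling,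
  will force a zero of the player's position without an early stop. At unit scale it has probability
  \<open>\<kappa> > 0\<close>, and a ceiling \<open>L\<close> is respected with probability above
  \<open>1 - \<kappa>\<close>, so both happen together with positive probability; scaling brings the
  ceiling down to \<open>a - l\<close>.\<close>

lemma excursion_pos:
  assumes a: "0 < a"
  obtains l d where "0 < l" "0 < d"
    "\<And>p A. 0 \<le> p \<Longrightarrow> A \<in> sets (F p) \<Longrightarrow> 0 < prob A \<Longrightarrow>
      0 < prob (A \<inter> {\<omega> \<in> space M. l \<le> W (p + d) \<omega> - W p \<omega> \<and> W (p + 2 * d) \<omega> - W p \<omega> \<le> - l} \<inter>
        {\<omega> \<in> space M. \<forall>r\<in>{0..2 * d}. W (p + r) \<omega> - W p \<omega> < a - l})"
proof -
  define \<kappa> where "\<kappa> = prob {\<omega> \<in> space M. 1 \<le> W 1 \<omega> \<and> W 2 \<omega> \<le> - 1}"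
  have \<kappa>: "0 < \<kappa>"
  proof -
    \<comment> \<open>From 0, a rise between 1 and 2 followed by a fall between 3 and 4 ends at or
      below \<open>-1\<close>.\<close>
    let ?D1 = "{\<omega> \<in> space M. W 1 \<omega> - W 0 \<omega> \<in> {1..2}}"
    let ?D2 = "{\<omega> \<in> space M. W 2 \<omega> - W 1 \<omega> \<in> {-4..-3}}"
    have "(\<lambda>\<omega>. W 1 \<omega> - W 0 \<omega>) \<in> borel_measurable (F 1)"
      by (intro borel_measurable_diff measurable_F) auto
    from measurable_sets[OF this, of "{1..2}"] have "?D1 \<in> sets (F 1)"
      by (simp add: vimage_def Int_def conj_commute)
    then have "prob (?D1 \<inter> ?D2) = prob ?D1 * prob ?D2"
      by (intro increment_indep) auto
    moreover have "0 < prob ?D1" "0 < prob ?D2"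
      by (intro increment_interval_pos; simp)+
    ultimately have "0 < prob (?D1 \<inter> ?D2)" by simp
    also have "\<dots> \<le> \<kappa>"
      unfolding \<kappa>_def
    proof (rule finite_measure_mono_AE)
      show "AE \<omega> in M. \<omega> \<in> ?D1 \<inter> ?D2 \<longrightarrow> \<omega> \<in> {\<omega> \<in> space M. 1 \<le> W 1 \<omega> \<and> W 2 \<omega> \<le> - 1}"
        using AE_start by eventually_elim auto
    qed measurable
    finally show ?thesis .
  qed
  obtain L where L: "0 < L" "1 - \<kappa> < prob {\<omega> \<in> space M. \<forall>r\<in>{0..2}. W r \<omega> < L}"
    using path_bounded_high_prob[of 2 "1 - \<kappa>"] \<kappa> by auto
  \<comment> \<open>The solution of \<open>l * L = a - l\<close>: the remaining \<open>l\<close> is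
    reserved for the distance from zero at which the excursion starts.\<close>
  define l where "l = a / (L + 1)"
  have l: "0 < l" "a - l = l * L" using a L by (auto simp: l_def field_simps)
  let ?B = "\<lambda>t \<omega>. l * W (t / l\<^sup>2) \<omega>"
  have BM: "brownian_motion M ?B" using l by (intro brownian_scaling)
  show ?thesis
  proof (rule that[of l "l\<^sup>2"])
    fix p A assume p: "0 \<le> p" and A: "A \<in> sets (F p)" and pos: "0 < prob A"
    let ?X = "{\<omega> \<in> space M. l \<le> W (p + l\<^sup>2) \<omega> - W p \<omega> \<and> W (p + 2 * l\<^sup>2) \<omega> - W p \<omega> \<le> - l}"
    let ?Y = "{\<omega> \<in> space M. \<forall>r\<in>{0..2 * l\<^sup>2}. W (p + r) \<omega> - W p \<omega> < a - l}"
    have A': "A \<in> events" using A by (rule sets_filtrationD)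
    have X_sets: "?X \<in> events"
    proof -
      have [measurable]: "W (p + l\<^sup>2) \<in> borel_measurable M" "W (p + 2 * l\<^sup>2) \<in> borel_measurable M" "W p \<in> borel_measurable M"
        using p by (auto intro: measurable_W)
      show ?thesis by measurable
    qed
    have Y_sets: "?Y \<in> events"
      using p l by (intro sets_filtrationD[OF sets_path_below(1)[of p "2 * l\<^sup>2" "p + 2 * l\<^sup>2"]]) auto
    have "prob (A \<inter> ?X) = prob A * \<kappa>"
    proof -
      \<comment> \<open>Three grid points \<open>p\<close>, \<open>p + l\<^sup>2\<close> and
        \<open>p + 2 * l\<^sup>2\<close>; the displacement at the first carries no
        condition.\<close>
      define g where "g i = (if i = 0 then (\<lambda>_. 1) else if i = 1 then indicator {l..} else indicator {..- l} :: real \<Rightarrow> ennreal)"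
        for i :: nat
      have g: "g i \<in> borel_measurable borel" for i by (auto simp: g_def)
      have "emeasure M (A \<inter> ?X) = (\<integral>\<^sup>+\<omega>. indicator (A \<inter> ?X) \<omega> \<partial>M)"
        using A' X_sets by simp
      also have "\<dots> = (\<integral>\<^sup>+\<omega>. indicator A \<omega> * (\<Prod>i\<le>2. g i (W (p + real i * l\<^sup>2) \<omega> - W p \<omega>)) \<partial>M)"
        by (intro nn_integral_cong) (auto simp: numeral_2_eq_2 g_def indicator_def)
      also have "\<dots> = emeasure M A * (\<integral>\<^sup>+\<omega>. (\<Prod>i\<le>2. g i (?B (real i * l\<^sup>2) \<omega>)) \<partial>M)"
        using p l g by (intro nn_integral_grid BM A) auto
      also have "(\<integral>\<^sup>+\<omega>. (\<Prod>i\<le>2. g i (?B (real i * l\<^sup>2) \<omega>)) \<partial>M) =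
          (\<integral>\<^sup>+\<omega>. indicator {\<omega> \<in> space M. 1 \<le> W 1 \<omega> \<and> W 2 \<omega> \<le> - 1} \<omega> \<partial>M)"
      proof (intro nn_integral_cong)
        fix \<omega> assume "\<omega> \<in> space M"
        have "(l \<le> l * W 1 \<omega>) = (1 \<le> W 1 \<omega>)" "(l * W 2 \<omega> \<le> - l) = (W 2 \<omega> \<le> - 1)"
          using l mult_le_cancel_left_pos[of l 1 "W 1 \<omega>"] mult_le_cancel_left_pos[of l "W 2 \<omega>" "-1"] by auto
        then show "(\<Prod>i\<le>2. g i (?B (real i * l\<^sup>2) \<omega>)) = indicator {\<omega> \<in> space M. 1 \<le> W 1 \<omega> \<and> W 2 \<omega> \<le> - 1} \<omega>"
          using l \<open>\<omega> \<in> space M\<close> by (simp add: numeral_2_eq_2 g_def indicator_def)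
      qed
      also have "\<dots> = \<kappa>"
        unfolding \<kappa>_def by (subst nn_integral_indicator) (measurable, simp add: emeasure_eq_measure)
      finally show ?thesis
        using \<kappa> by (simp add: emeasure_eq_measure flip: ennreal_mult)
    qed
    moreover have "prob (A \<inter> ?Y) = prob A * prob {\<omega> \<in> space M. \<forall>r\<in>{0..2}. W r \<omega> < L}"
    proof -
      have "prob (A \<inter> ?Y) = prob A * prob {\<omega> \<in> space M. \<forall>r\<in>{0..2 * l\<^sup>2}. ?B r \<omega> < a - l}"
        using l by (intro markov_property BM p A) auto
      also have "{\<omega> \<in> space M. \<forall>r\<in>{0..2 * l\<^sup>2}. ?B r \<omega> < a - l} = {\<omega> \<in> space M. \<forall>r\<in>{0..2}. W r \<omega> < L}"
      proof -
        have "(\<forall>r\<in>{0..2 * l\<^sup>2}. ?B r \<omega> < l * L) \<longleftrightarrow> (\<forall>r\<in>{0..2}. W r \<omega> < L)" for \<omega>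
        proof safe
          fix r :: real assume *: "\<forall>r\<in>{0..2 * l\<^sup>2}. ?B r \<omega> < l * L" and r: "r \<in> {0..2}"
          have "?B (r * l\<^sup>2) \<omega> < l * L" using r by (intro *[rule_format]) (auto intro: mult_right_mono)
          then show "W r \<omega> < L" using l by simp
        next
          fix r :: real assume *: "\<forall>r\<in>{0..2}. W r \<omega> < L" and r: "r \<in> {0..2 * l\<^sup>2}"
          have "W (r / l\<^sup>2) \<omega> < L" using r l by (intro *[rule_format]) (auto simp: field_simps)
          then show "?B r \<omega> < l * L" using l by simp
        qed
        then show ?thesis unfolding l(2) by simp
      qed
      finally show ?thesis .
    qed
    \<comment> \<open>Inclusion-exclusion takes the place of independence of \<open>?X\<close> and
      \<open>?Y\<close>: their shares of \<open>A\<close> add up to more than 1, so they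
      overlap.\<close>
    moreover have "prob (A \<inter> ?X) + prob (A \<inter> ?Y) \<le> prob A + prob (A \<inter> ?X \<inter> ?Y)"
    proof -
      have "prob (A \<inter> ?X \<union> A \<inter> ?Y) = prob (A \<inter> ?X) + prob (A \<inter> ?Y) - prob ((A \<inter> ?X) \<inter> (A \<inter> ?Y))"
        using A' X_sets Y_sets measure_Un3[of "A \<inter> ?X" M "A \<inter> ?Y"] by (simp add: fmeasurable_eq_sets)
      moreover have "prob (A \<inter> ?X \<union> A \<inter> ?Y) \<le> prob A"
        using A' by (intro finite_measure_mono) auto
      moreover have "(A \<inter> ?X) \<inter> (A \<inter> ?Y) = A \<inter> ?X \<inter> ?Y" by blast
      ultimately show ?thesis by simp
    qed
    moreover have "0 < prob A * (\<kappa> + prob {\<omega> \<in> space M. \<forall>r\<in>{0..2}. W r \<omega> < L} - 1)"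
      using pos L(2) by (intro mult_pos_pos) auto
    ultimately show "0 < prob (A \<inter> ?X \<inter> ?Y)"
      by (simp add: algebra_simps)
  qed (use l in auto)
qed

text \<open>Keeps the first zero after \<open>p\<close> while bringing the path so close that an
  excursion of size \<open>l\<close> must produce one. The path crosses or reaches zero by time 1
  with positive probability, and by continuity some rational time just before its first zero has the
  required property; hence the countably many events cannot all be null. The factor
  \<open>sgn x\<close> treats both signs of \<open>x\<close> at once.\<close>

lemma approach_pos:
  assumes x: "x \<noteq> 0" and l: "0 < l"
  obtains p where "0 \<le> p"
    "{\<omega> \<in> space M. (\<forall>r\<in>{0..p}. - (sgn x * (x + W r \<omega>)) < 0) \<and> \<bar>x + W p \<omega>\<bar> < l} \<in> sets (F p)"
    "0 < prob {\<omega> \<in> space M. (\<forall>r\<in>{0..p}. - (sgn x * (x + W r \<omega>)) < 0) \<and> \<bar>x + W p \<omega>\<bar> < l}"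
proof -
  define A where "A p = {\<omega> \<in> space M. (\<forall>r\<in>{0..p}. - (sgn x * (x + W r \<omega>)) < 0) \<and> \<bar>x + W p \<omega>\<bar> < l}" for p
  have A_F: "A p \<in> sets (F p)" if "0 \<le> p" for p
  proof -
    have "{\<omega> \<in> space (F p). \<forall>r\<in>{0..p}. - (sgn x * (x + W r \<omega>)) < 0} \<in> sets (F p)"
      using that by (intro sets_all_less borel_measurable_uminus borel_measurable_times borel_measurable_add
        borel_measurable_const measurable_F continuous_intros continuous_on_subset[OF continuous_path]) auto
    moreover have "{\<omega> \<in> space (F p). \<bar>x + W p \<omega>\<bar> < l} \<in> sets (F p)"
      using that by (intro borel_measurable_less borel_measurable_abs borel_measurable_add
        borel_measurable_const measurable_F) auto
    moreover have "A p = {\<omega> \<in> space (F p). \<forall>r\<in>{0..p}. - (sgn x * (x + W r \<omega>)) < 0} \<inter>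
        {\<omega> \<in> space (F p). \<bar>x + W p \<omega>\<bar> < l}"
      unfolding A_def space_natural_filtration by blast
    ultimately show ?thesis by simp
  qed
  have "\<exists>p\<in>\<rat> \<inter> {0..}. 0 < prob (A p)"
  proof (rule ccontr)
    assume neg: "\<not> ?thesis"
    have "A p \<in> null_sets M" if "p \<in> \<rat> \<inter> {0..}" for p
    proof -
      have "\<not> 0 < prob (A p)" using neg that by blast
      then have "prob (A p) = 0" using measure_nonneg[of M "A p"] by linarith
      then show ?thesis using sets_filtrationD[OF A_F] that by (auto simp: null_sets_def emeasure_eq_measure)
    qed
    then have null: "(\<Union>p\<in>\<rat> \<inter> {0..}. A p) \<in> null_sets M"
      by (intro null_sets_UN') (auto simp: countable_rat)
    \<comment> \<open>With this choice \<open>x + W 1\<close> falls into \<open>[-1, 0]\<close> if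
      \<open>x > 0\<close> and into \<open>[0, 1]\<close> if \<open>x < 0\<close>, when
      \<open>W 0\<close> is 0.\<close>
    define c where "c = (if x > 0 then - x - 1 else - x)"
    let ?D = "{\<omega> \<in> space M. W 1 \<omega> - W 0 \<omega> \<in> {c..c + 1}}"
    have "AE \<omega> in M. \<omega> \<notin> ?D"
      using AE_not_in[OF null] AE_start AE_space
    proof eventually_elim
      fix \<omega> assume notin: "\<omega> \<notin> (\<Union>p\<in>\<rat> \<inter> {0..}. A p)" and start: "W 0 \<omega> = 0" and \<omega>: "\<omega> \<in> space M"
      show "\<omega> \<notin> ?D"
      proof
        assume "\<omega> \<in> ?D"
        define y where "y r = sgn x * (x + W r \<omega>)" for r
        have y0: "0 < y 0" using x start by (auto simp: y_def sgn_real_def)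
        have y1: "y 1 \<le> 0" using \<open>\<omega> \<in> ?D\<close> start x by (auto simp: y_def sgn_real_def c_def split: if_splits)
        have cont: "continuous_on {0..} y"
          unfolding y_def by (intro continuous_intros continuous_path \<omega>)
        obtain t where t: "0 \<le> t" "y t = 0"
          using IVT2'[of y 1 0 0] y0 y1 continuous_on_subset[OF cont, of "{0..1}"] by fastforce
        have "W t \<omega> = - x" using t x by (auto simp: y_def sgn_real_def split: if_splits)
        then obtain z where z: "0 \<le> z" "W z \<omega> = - x" "\<And>s. 0 \<le> s \<Longrightarrow> W s \<omega> = - x \<Longrightarrow> z \<le> s"
          by (rule hitting_time_attained[of W \<omega>, OF continuous_path[OF \<omega>] t(1)]) (rule that, assumption+)
        have before: "0 < y r" if r: "0 \<le> r" "r < z" for r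
        proof (rule ccontr)
          assume "\<not> 0 < y r"
          then obtain s where s: "0 \<le> s" "s \<le> r" "y s = 0"
            using IVT2'[of y r 0 0] y0 r continuous_on_subset[OF cont, of "{0..r}"] by fastforce
          then have "W s \<omega> = - x" using x by (auto simp: y_def sgn_real_def split: if_splits)
          from z(3)[OF s(1) this] show False using s(2) r(2) by simp
        qed
        have yz: "y z = 0" using z by (simp add: y_def)
        have "0 < z" using z yz y0 by (metis less_eq_real_def less_irrefl)
        have "continuous (at z within {0..}) y" using cont z by (auto simp: continuous_on_eq_continuous_within)
        then obtain e where e: "0 < e" "\<And>r. 0 \<le> r \<Longrightarrow> dist r z < e \<Longrightarrow> dist (y r) (y z) < l"
          using l unfolding continuous_within_eps_delta by (metis atLeast_iff)
        obtain p where p: "p \<in> \<rat>" "max 0 (z - e) < p" "p < z"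
          using Rats_dense_in_real[of "max 0 (z - e)" z] \<open>0 < z\<close> e by auto
        have "\<bar>y p\<bar> < l" using e(2)[of p] p yz by (auto simp: dist_real_def)
        then have "\<bar>x + W p \<omega>\<bar> < l" using x by (auto simp: y_def sgn_real_def split: if_splits)
        moreover have "\<forall>r\<in>{0..p}. - (sgn x * (x + W r \<omega>)) < 0"
          using before p by (auto simp: y_def)
        ultimately have "\<omega> \<in> A p" using \<omega> by (simp add: A_def)
        then show False using notin p by auto
      qed
    qed
    then have "prob ?D = 0"
      by (subst prob_eq_0) measurable
    then show False using increment_interval_pos[of 0 1 c "c + 1"] by simp
  qed
  then show ?thesis using that A_F by (auto simp: A_def)
qed

text \<open>The last condition, \<open>x + W K \<omega> \<le> 0\<close>, lets the Markov property at the fixed time \<open>K\<close> replace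
  the strong Markov property at the hitting time.\<close>

lemma start_event:
  assumes a: "0 < a"
  obtains K E where "0 \<le> K" "E \<in> sets (F K)" "0 < prob E"
    "\<And>\<omega>. \<omega> \<in> E \<Longrightarrow> \<exists>\<sigma>. 0 \<le> \<sigma> \<and> \<sigma> \<le> K \<and> hitting_time W (- x) \<omega> = ennreal \<sigma> \<and>
       (\<forall>s. \<sigma> \<le> s \<and> s \<le> K \<longrightarrow> x + W s \<omega> < a * sqrt (s - \<sigma> + 1)) \<and> x + W K \<omega> \<le> 0"
proof (cases "x = 0")
  case True
  let ?E = "{\<omega> \<in> space M. W 0 \<omega> = 0}"
  show ?thesis
  proof (rule that[of 0 ?E])
    have "{\<omega> \<in> space (F 0). W 0 \<omega> = 0} \<in> sets (F 0)"
      by (intro borel_measurable_eq measurable_F) auto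
    then show "?E \<in> sets (F 0)" by simp
    have "prob ?E = 1" using AE_start by (subst prob_Collect_eq_1) auto
    then show "0 < prob ?E" by simp
    fix \<omega> assume "\<omega> \<in> ?E"
    then have \<omega>: "\<omega> \<in> space M" "W 0 \<omega> = 0" by auto
    from hitting_time_attained[of W \<omega>, OF continuous_path[OF \<omega>(1)] order_refl \<omega>(2)]
    have "hitting_time W 0 \<omega> = ennreal 0" by (metis antisym)
    then show "\<exists>\<sigma>. 0 \<le> \<sigma> \<and> \<sigma> \<le> 0 \<and> hitting_time W (- x) \<omega> = ennreal \<sigma> \<and>
       (\<forall>s. \<sigma> \<le> s \<and> s \<le> 0 \<longrightarrow> x + W s \<omega> < a * sqrt (s - \<sigma> + 1)) \<and> x + W 0 \<omega> \<le> 0"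
      using \<omega> a True by (intro exI[of _ 0]) auto
  qed simp
next
  case False
  obtain l d where ld: "0 < l" "0 < d"
    "\<And>p A. 0 \<le> p \<Longrightarrow> A \<in> sets (F p) \<Longrightarrow> 0 < prob A \<Longrightarrow>
      0 < prob (A \<inter> {\<omega> \<in> space M. l \<le> W (p + d) \<omega> - W p \<omega> \<and> W (p + 2 * d) \<omega> - W p \<omega> \<le> - l} \<inter>
        {\<omega> \<in> space M. \<forall>r\<in>{0..2 * d}. W (p + r) \<omega> - W p \<omega> < a - l})"
    by (rule excursion_pos[OF a]) (rule that, assumption+)
  obtain p where p: "0 \<le> p"
    "{\<omega> \<in> space M. (\<forall>r\<in>{0..p}. - (sgn x * (x + W r \<omega>)) < 0) \<and> \<bar>x + W p \<omega>\<bar> < l} \<in> sets (F p)"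
    "0 < prob {\<omega> \<in> space M. (\<forall>r\<in>{0..p}. - (sgn x * (x + W r \<omega>)) < 0) \<and> \<bar>x + W p \<omega>\<bar> < l}"
    by (rule approach_pos[OF False ld(1)]) (rule that, assumption+)
  let ?A = "{\<omega> \<in> space M. (\<forall>r\<in>{0..p}. - (sgn x * (x + W r \<omega>)) < 0) \<and> \<bar>x + W p \<omega>\<bar> < l}"
  let ?X = "{\<omega> \<in> space M. l \<le> W (p + d) \<omega> - W p \<omega> \<and> W (p + 2 * d) \<omega> - W p \<omega> \<le> - l}"
  let ?Y = "{\<omega> \<in> space M. \<forall>r\<in>{0..2 * d}. W (p + r) \<omega> - W p \<omega> < a - l}"
  let ?K = "p + 2 * d"
  show ?thesis
  proof (rule that[of ?K "?A \<inter> ?X \<inter> ?Y"])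
    show "0 \<le> ?K" using p ld by auto
    show "0 < prob (?A \<inter> ?X \<inter> ?Y)" by (rule ld(3)[OF p])
    have "{\<omega> \<in> space (F ?K). l \<le> W (p + d) \<omega> - W p \<omega> \<and> W (p + 2 * d) \<omega> - W p \<omega> \<le> - l} \<in> sets (F ?K)"
    proof -
      have [measurable]: "W (p + d) \<in> borel_measurable (F ?K)" "W (p + 2 * d) \<in> borel_measurable (F ?K)" "W p \<in> borel_measurable (F ?K)"
        using p(1) ld(1,2) by (intro measurable_F; linarith)+
      show ?thesis by measurable
    qed
    then show "?A \<inter> ?X \<inter> ?Y \<in> sets (F ?K)"
      using p(1) ld by (intro sets.Int F_mono[OF _ p(2)] sets_path_below(1)) auto
    fix \<omega> assume "\<omega> \<in> ?A \<inter> ?X \<inter> ?Y"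
    then have \<omega>: "\<omega> \<in> space M" "\<And>r. 0 \<le> r \<Longrightarrow> r \<le> p \<Longrightarrow> x + W r \<omega> \<noteq> 0" "\<bar>x + W p \<omega>\<bar> < l"
      "l \<le> W (p + d) \<omega> - W p \<omega>" "W (p + 2 * d) \<omega> - W p \<omega> \<le> - l"
      and up: "\<And>r. 0 \<le> r \<Longrightarrow> r \<le> 2 * d \<Longrightarrow> W (p + r) \<omega> - W p \<omega> < a - l"
      by force+
    have cont: "continuous_on {0..} (\<lambda>t. W t \<omega>)" using \<omega>(1) by (rule continuous_path)
    \<comment> \<open>At time \<open>p\<close> the position is closer than \<open>l\<close> to zero,
      so the two halves of the excursion end on opposite sides of zero, whatever the sign of
      \<open>x\<close>.\<close>
    have "- x \<le> W (p + d) \<omega>" "W (p + 2 * d) \<omega> \<le> - x" using \<omega> by auto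
    then obtain t where t: "p + d \<le> t" "t \<le> p + 2 * d" "W t \<omega> = - x"
      using IVT2'[of "\<lambda>t. W t \<omega>" "p + 2 * d" "- x" "p + d"] ld p continuous_on_subset[OF cont, of "{p + d..p + 2 * d}"]
      by auto
    from hitting_time_attained[of W \<omega>, OF cont _ t(3)] t(1) p ld obtain \<sigma> where
      \<sigma>: "0 \<le> \<sigma>" "\<sigma> \<le> t" "hitting_time W (- x) \<omega> = ennreal \<sigma>" "W \<sigma> \<omega> = - x"
      by (metis add_nonneg_nonneg order_trans less_imp_le)
    \<comment> \<open>The boundary only becomes active at \<open>\<sigma>\<close>, hence inside the
      excursion, where the ceiling \<open>a - l\<close> and the initial distance below
      \<open>l\<close> keep the position under \<open>a\<close>.\<close>
    have "p < \<sigma>" using \<omega>(2)[of \<sigma>] \<sigma> by force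
    have "x + W s \<omega> < a * sqrt (s - \<sigma> + 1)" if s: "\<sigma> \<le> s" "s \<le> ?K" for s
    proof -
      have "x + W s \<omega> < a" using up[of "s - p"] s \<open>p < \<sigma>\<close> \<omega>(3) by auto
      also have "a * 1 \<le> a * sqrt (s - \<sigma> + 1)" using a s by (intro mult_left_mono) auto
      finally show ?thesis by simp
    qed
    moreover have "x + W ?K \<omega> \<le> 0" using \<omega> by auto
    ultimately show "\<exists>\<sigma>. 0 \<le> \<sigma> \<and> \<sigma> \<le> ?K \<and> hitting_time W (- x) \<omega> = ennreal \<sigma> \<and>
       (\<forall>s. \<sigma> \<le> s \<and> s \<le> ?K \<longrightarrow> x + W s \<omega> < a * sqrt (s - \<sigma> + 1)) \<and> x + W ?K \<omega> \<le> 0"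
      using \<sigma> t by (intro exI[of _ \<sigma>]) auto
  qed
qed

end

section \<open>The stopping times\<close>

lemma hitting_time_finiteE:
  assumes cont: "continuous_on {0..} (\<lambda>t. W t \<omega>)" and fin: "hitting_time W \<xi> \<omega> < \<infinity>"
  obtains \<sigma> where "0 \<le> \<sigma>" "hitting_time W \<xi> \<omega> = ennreal \<sigma>" "W \<sigma> \<omega> = \<xi>"
proof -
  have "{ennreal t | t. 0 \<le> t \<and> W t \<omega> = \<xi>} \<noteq> {}"
    using fin by (auto simp: hitting_time_def simp del: Collect_empty_eq)
  then obtain t where t: "0 \<le> t" "W t \<omega> = \<xi>" by blast
  show ?thesis
    using cont t by (rule hitting_time_attained) (rule that, assumption+)
qed

text \<open>Finiteness excludes empty sets in both infima; continuity makes the sets closed, so the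
  hitting time and the stopping time are minima.\<close>

lemma sqrt_boundary_time_finiteE:
  assumes cont: "continuous_on {0..} (\<lambda>t. W t \<omega>)" and fin: "sqrt_boundary_time a x W \<omega> < \<infinity>"
  obtains \<sigma> \<tau> where "0 \<le> \<sigma>" "\<sigma> \<le> \<tau>" "hitting_time W (- x) \<omega> = ennreal \<sigma>" "W \<sigma> \<omega> = - x"
    "sqrt_boundary_time a x W \<omega> = ennreal \<tau>" "a * sqrt (\<tau> - \<sigma> + 1) \<le> x + W \<tau> \<omega>"
    "\<And>s. \<sigma> \<le> s \<Longrightarrow> a * sqrt (s - \<sigma> + 1) \<le> x + W s \<omega> \<Longrightarrow> \<tau> \<le> s"
proof -
  have "{ennreal s | s. 0 \<le> s \<and> hitting_time W (- x) \<omega> \<le> ennreal s \<and>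
            x + W s \<omega> \<ge> a * sqrt (s - enn2real (hitting_time W (- x) \<omega>) + 1)} \<noteq> {}"
    using fin by (auto simp: sqrt_boundary_time_def simp del: Collect_empty_eq)
  then obtain s where s: "0 \<le> s" "hitting_time W (- x) \<omega> \<le> ennreal s"
      "x + W s \<omega> \<ge> a * sqrt (s - enn2real (hitting_time W (- x) \<omega>) + 1)"
    by auto
  have "hitting_time W (- x) \<omega> < \<infinity>"
    using s(2) by (simp add: order_le_less_trans)
  with cont obtain \<sigma> where \<sigma>: "0 \<le> \<sigma>" "hitting_time W (- x) \<omega> = ennreal \<sigma>" "W \<sigma> \<omega> = - x"
    by (rule hitting_time_finiteE) (rule that, assumption+)
  define S where "S = {s. \<sigma> \<le> s \<and> a * sqrt (s - \<sigma> + 1) \<le> x + W s \<omega>}"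
  have "S = {\<sigma>..} \<inter> (\<lambda>s. x + W s \<omega> - a * sqrt (s - \<sigma> + 1)) -` {0..}"
    by (auto simp: S_def)
  moreover have "continuous_on {\<sigma>..} (\<lambda>s. x + W s \<omega> - a * sqrt (s - \<sigma> + 1))"
    using \<sigma>(1) by (intro continuous_intros continuous_on_subset[OF cont]) auto
  ultimately have S: "closed S"
    using continuous_closed_preimage[of "{\<sigma>..}" _ "{0::real..}"] by simp
  have ne: "S \<noteq> {}" "S \<subseteq> {0..}" using s \<sigma> by (auto simp: S_def)
  have bdd: "bdd_below S" by (intro bdd_belowI[of _ \<sigma>]) (auto simp: S_def)
  have "sqrt_boundary_time a x W \<omega> = Inf (ennreal ` S)"
    unfolding sqrt_boundary_time_def S_def \<sigma>(2)
    using \<sigma>(1) by (intro arg_cong[where f = Inf]) auto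
  then have "sqrt_boundary_time a x W \<omega> = ennreal (Inf S)" "Inf S \<in> S"
    using Inf_ennreal_image_closed[OF S ne(2,1)] by auto
  moreover have "Inf S \<le> s" if "\<sigma> \<le> s" "a * sqrt (s - \<sigma> + 1) \<le> x + W s \<omega>" for s
    using bdd that by (intro cInf_lower) (auto simp: S_def)
  ultimately show ?thesis using that \<sigma> by (auto simp: S_def)
qed

lemma sqrt_boundary_time_le:
  assumes "hitting_time W (- x) \<omega> = ennreal \<sigma>" "0 \<le> \<sigma>" "\<sigma> \<le> s" "a * sqrt (s - \<sigma> + 1) \<le> x + W s \<omega>"
  shows "sqrt_boundary_time a x W \<omega> \<le> ennreal s"
  unfolding sqrt_boundary_time_def using assms by (intro Inf_lower) auto

text \<open>At the hitting time the position is 0, below both boundaries. When the higher boundary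
  is met the path is strictly above the lower one, so it crossed the lower one strictly earlier.
  This separates the equilibria for different \<open>a\<close>.\<close>

lemma sqrt_boundary_time_less:
  assumes cont: "continuous_on {0..} (\<lambda>t. W t \<omega>)" and a: "0 < a" "a < a'"
    and fin: "sqrt_boundary_time a x W \<omega> < \<infinity>"
  shows "sqrt_boundary_time a x W \<omega> < sqrt_boundary_time a' x W \<omega>"
proof (rule ccontr)
  assume "\<not> ?thesis"
  then have le: "sqrt_boundary_time a' x W \<omega> \<le> sqrt_boundary_time a x W \<omega>" by simp
  then have fin': "sqrt_boundary_time a' x W \<omega> < \<infinity>" using fin by (rule le_less_trans)
  obtain \<sigma> \<tau> where 1: "0 \<le> \<sigma>" "hitting_time W (- x) \<omega> = ennreal \<sigma>" "W \<sigma> \<omega> = - x" "\<sigma> \<le> \<tau>"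
    "sqrt_boundary_time a x W \<omega> = ennreal \<tau>"
    "\<And>s. \<sigma> \<le> s \<Longrightarrow> a * sqrt (s - \<sigma> + 1) \<le> x + W s \<omega> \<Longrightarrow> \<tau> \<le> s"
    using cont fin by (rule sqrt_boundary_time_finiteE) (rule that, assumption+)
  obtain \<sigma>' \<tau>' where 2: "0 \<le> \<sigma>'" "hitting_time W (- x) \<omega> = ennreal \<sigma>'" "\<sigma>' \<le> \<tau>'"
    "sqrt_boundary_time a' x W \<omega> = ennreal \<tau>'" "a' * sqrt (\<tau>' - \<sigma>' + 1) \<le> x + W \<tau>' \<omega>"
    using cont fin' by (rule sqrt_boundary_time_finiteE) (rule that, assumption+)
  have \<sigma>: "\<sigma>' = \<sigma>" using 1 2 by simp
  have "\<tau>' \<le> \<tau>" using le 1 2 by simp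
  let ?g = "\<lambda>s. x + W s \<omega> - a * sqrt (s - \<sigma> + 1)"
  have pos: "0 < ?g \<tau>'"
  proof -
    have "a * sqrt (\<tau>' - \<sigma> + 1) < a' * sqrt (\<tau>' - \<sigma> + 1)"
      using a 2 \<sigma> by (intro mult_strict_right_mono) auto
    then show ?thesis using 2(5) unfolding \<sigma> by linarith
  qed
  have "?g \<sigma> \<le> 0" using 1 a by simp
  moreover have "continuous_on {\<sigma>..\<tau>'} ?g"
    using 1 by (intro continuous_intros continuous_on_subset[OF cont]) auto
  ultimately obtain s where s: "\<sigma> \<le> s" "s \<le> \<tau>'" "?g s = 0"
    using IVT'[of ?g \<sigma> 0 \<tau>'] pos 2 \<sigma> by auto
  then have "\<tau> \<le> s" using 1(6)[of s] by simp
  then have "s = \<tau>'" using s \<open>\<tau>' \<le> \<tau>\<close> by simp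
  then show False using pos s by simp
qed

section \<open>Measurability and survival of the stopping times\<close>

context brownian_motion
begin

text \<open>Not having hit \<open>\<xi>\<close> by time \<open>r\<close> means that
  \<open>- \<bar>W s \<omega> - \<xi>\<bar>\<close> is strictly negative on all of
  \<open>{0..r}\<close>, an event of the past by the dyadic description.\<close>

lemma stopping_time_hitting_time: "stopping_time (natural_filtration M W) (hitting_time W \<xi>)"
proof
  fix t :: ennreal
  show "Measurable.pred (natural_filtration M W t) (\<lambda>\<omega>. hitting_time W \<xi> \<omega> \<le> t)"
  proof (cases t)
    case (real r)
    have iff: "hitting_time W \<xi> \<omega> \<le> ennreal r \<longleftrightarrow> \<not> (\<forall>s\<in>{0..r}. - \<bar>W s \<omega> - \<xi>\<bar> < 0)"
      if \<omega>: "\<omega> \<in> space M" for \<omega>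
    proof
      assume le: "hitting_time W \<xi> \<omega> \<le> ennreal r"
      then have "hitting_time W \<xi> \<omega> < \<infinity>" by (simp add: order_le_less_trans)
      with continuous_path[OF \<omega>] obtain \<sigma> where "0 \<le> \<sigma>" "hitting_time W \<xi> \<omega> = ennreal \<sigma>" "W \<sigma> \<omega> = \<xi>"
        by (rule hitting_time_finiteE) (rule that, assumption+)
      then show "\<not> (\<forall>s\<in>{0..r}. - \<bar>W s \<omega> - \<xi>\<bar> < 0)" using le real by force
    next
      assume "\<not> (\<forall>s\<in>{0..r}. - \<bar>W s \<omega> - \<xi>\<bar> < 0)"
      then obtain s where s: "0 \<le> s" "s \<le> r" "W s \<omega> = \<xi>" by auto
      then have "hitting_time W \<xi> \<omega> \<le> ennreal s" unfolding hitting_time_def by (intro Inf_lower) auto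
      also have "\<dots> \<le> ennreal r" using s by (intro ennreal_leI)
      finally show "hitting_time W \<xi> \<omega> \<le> ennreal r" .
    qed
    have "{\<omega> \<in> space (F r). \<forall>s\<in>{0..r}. - \<bar>W s \<omega> - \<xi>\<bar> < 0} \<in> sets (F r)"
      using real by (intro sets_all_less borel_measurable_uminus borel_measurable_abs borel_measurable_diff
        borel_measurable_const measurable_F continuous_intros continuous_on_subset[OF continuous_path]) auto
    then have "space (F r) - {\<omega> \<in> space (F r). \<forall>s\<in>{0..r}. - \<bar>W s \<omega> - \<xi>\<bar> < 0} \<in> sets (F r)"
      by (rule sets.compl_sets)
    also have "space (F r) - {\<omega> \<in> space (F r). \<forall>s\<in>{0..r}. - \<bar>W s \<omega> - \<xi>\<bar> < 0} =
        {\<omega> \<in> space (F r). hitting_time W \<xi> \<omega> \<le> ennreal r}"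
      using iff by auto
    finally show ?thesis unfolding pred_def real .
  qed simp
qed

text \<open>The square root boundary is random through its starting time. Truncation at
  \<open>r\<close> makes that time a function of the past up to \<open>r\<close>.\<close>

lemma measurable_min_hitting_time:
  assumes "0 \<le> r"
  shows "(\<lambda>\<omega>. enn2real (min (hitting_time W \<xi> \<omega>) (ennreal r))) \<in> borel_measurable (F r)"
proof -
  have "(\<lambda>\<omega>. min (hitting_time W \<xi> \<omega>) (ennreal r)) \<in> borel_measurable (F r)"
  proof (rule borel_measurableI_le)
    fix y :: ennreal
    show "{\<omega> \<in> space (F r). min (hitting_time W \<xi> \<omega>) (ennreal r) \<le> y} \<in> sets (F r)"
    proof (cases "ennreal r \<le> y")
      case True
      then show ?thesis using sets.top[of "F r"] by (simp add: min_le_iff_disj)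
    next
      case False
      then have eq: "{\<omega> \<in> space (F r). min (hitting_time W \<xi> \<omega>) (ennreal r) \<le> y} =
          {\<omega> \<in> space (natural_filtration M W y). hitting_time W \<xi> \<omega> \<le> y}"
        by (simp add: min_le_iff_disj)
      have "\<dots> \<in> sets (natural_filtration M W y)"
        using stopping_timeD[OF stopping_time_hitting_time] by (simp add: pred_def)
      moreover have "sets (natural_filtration M W y) \<subseteq> sets (F r)"
        using False by (intro natural_filtration_mono) simp
      ultimately show ?thesis unfolding eq by blast
    qed
  qed
  then show ?thesis by measurable
qed

lemma stopping_time_sqrt_boundary_time:
  "stopping_time (natural_filtration M W) (sqrt_boundary_time a x W)"
proof
  fix t :: ennreal
  show "Measurable.pred (natural_filtration M W t) (\<lambda>\<omega>. sqrt_boundary_time a x W \<omega> \<le> t)"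
  proof (cases t)
    case (real r)
    define s where "s \<omega> = enn2real (min (hitting_time W (- x) \<omega>) (ennreal r))" for \<omega>
    \<comment> \<open>Nonnegative exactly if \<open>q\<close> is not before
      \<open>s \<omega>\<close> and the position is on or above the boundary. The \<open>max\<close>
      changes the boundary only before \<open>s \<omega>\<close>, where the second entry is negative
      anyway. A value \<open>r\<close> due only to truncation is excluded by the separate condition
      on the hitting time.\<close>
    define Z where "Z q \<omega> = min (x + W q \<omega> - a * sqrt (max (q - s \<omega>) 0 + 1)) (q - s \<omega>)" for q \<omega>
    have s_meas: "s \<in> borel_measurable (F r)"
      unfolding s_def using real by (intro measurable_min_hitting_time) auto
    have iff: "sqrt_boundary_time a x W \<omega> \<le> ennreal r \<longleftrightarrow>
        hitting_time W (- x) \<omega> \<le> ennreal r \<and> \<not> (\<forall>q\<in>{0..r}. Z q \<omega> < 0)"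
      if \<omega>: "\<omega> \<in> space M" for \<omega>
    proof
      assume le: "sqrt_boundary_time a x W \<omega> \<le> ennreal r"
      then have "sqrt_boundary_time a x W \<omega> < \<infinity>" by (simp add: order_le_less_trans)
      with continuous_path[OF \<omega>] obtain \<sigma> \<tau> where *: "0 \<le> \<sigma>" "\<sigma> \<le> \<tau>" "hitting_time W (- x) \<omega> = ennreal \<sigma>"
        "sqrt_boundary_time a x W \<omega> = ennreal \<tau>" "a * sqrt (\<tau> - \<sigma> + 1) \<le> x + W \<tau> \<omega>"
        by (rule sqrt_boundary_time_finiteE) (rule that, assumption+)
      have "\<tau> \<le> r" using le * real by simp
      then have "s \<omega> = \<sigma>" using * by (simp add: s_def min_def ennreal_leI)
      then have "\<not> Z \<tau> \<omega> < 0" using * by (simp add: Z_def)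
      then show "hitting_time W (- x) \<omega> \<le> ennreal r \<and> \<not> (\<forall>q\<in>{0..r}. Z q \<omega> < 0)"
        using * \<open>\<tau> \<le> r\<close> by (auto simp: ennreal_leI)
    next
      assume asm: "hitting_time W (- x) \<omega> \<le> ennreal r \<and> \<not> (\<forall>q\<in>{0..r}. Z q \<omega> < 0)"
      then obtain q where q: "0 \<le> q" "q \<le> r" "0 \<le> Z q \<omega>" by auto
      have "hitting_time W (- x) \<omega> = ennreal (s \<omega>)"
        using asm order_le_less_trans[OF conjunct1[OF asm] ennreal_less_top]
        by (simp add: s_def min_absorb1 ennreal_enn2real)
      then have "sqrt_boundary_time a x W \<omega> \<le> ennreal q"
        using q by (intro sqrt_boundary_time_le[of W x \<omega> "s \<omega>"]) (auto simp: Z_def s_def)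
      also have "\<dots> \<le> ennreal r" using q by (intro ennreal_leI)
      finally show "sqrt_boundary_time a x W \<omega> \<le> ennreal r" .
    qed
    have "{\<omega> \<in> space (F r). \<forall>q\<in>{0..r}. Z q \<omega> < 0} \<in> sets (F r)"
    proof (rule sets_all_less)
      fix q assume "q \<in> {0..r}"
      then have [measurable]: "W q \<in> borel_measurable (F r)" by (intro measurable_F) auto
      note [measurable] = s_meas
      show "Z q \<in> borel_measurable (F r)" unfolding Z_def by measurable
    next
      fix \<omega> assume "\<omega> \<in> space (F r)"
      then show "continuous_on {0..r} (\<lambda>q. Z q \<omega>)"
        unfolding Z_def by (intro continuous_intros continuous_on_subset[OF continuous_path]) auto
    qed (use real in auto)
    moreover have "{\<omega> \<in> space (F r). hitting_time W (- x) \<omega> \<le> ennreal r} \<in> sets (F r)"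
      using stopping_timeD[OF stopping_time_hitting_time] by (simp add: pred_def)
    ultimately have "{\<omega> \<in> space (F r). hitting_time W (- x) \<omega> \<le> ennreal r} -
        {\<omega> \<in> space (F r). \<forall>q\<in>{0..r}. Z q \<omega> < 0} \<in> sets (F r)"
      by (intro sets.Diff)
    also have "{\<omega> \<in> space (F r). hitting_time W (- x) \<omega> \<le> ennreal r} -
        {\<omega> \<in> space (F r). \<forall>q\<in>{0..r}. Z q \<omega> < 0} = {\<omega> \<in> space (F r). sqrt_boundary_time a x W \<omega> \<le> ennreal r}"
      using iff by auto
    finally show ?thesis unfolding pred_def real .
  qed simp
qed

lemma measurable_sqrt_boundary_time [measurable]: "sqrt_boundary_time a x W \<in> borel_measurable M"
  using stopping_time_sqrt_boundary_time sets_filtration_subset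
  by (intro measurable_stopping_time[where F = "natural_filtration M W"]) auto

text \<open>The player's boundary is counted from a time before \<open>K\<close>, so after
  \<open>K\<close> it lies above the boundary counted from \<open>K\<close>, and the position at
  \<open>K\<close> is at most 0; both favour survival. Removing the null event of no crossing at
  late integer times makes the stop finite at no cost in probability.\<close>

lemma survival_bound:
  assumes BM: "brownian_motion N B" and a: "0 < a"
  obtains K E where "0 \<le> K" "E \<in> events" "0 < prob E"
    "\<And>\<omega>. \<omega> \<in> E \<Longrightarrow> hitting_time W (- x) \<omega> \<le> ennreal K"
    "\<And>u. 0 < u \<Longrightarrow> prob E * measure N {\<omega> \<in> space N. \<forall>r\<in>{0..u}. B r \<omega> < a * sqrt (r + 1)} \<le>
       prob {\<omega> \<in> E. ennreal (K + u) < sqrt_boundary_time a x W \<omega> \<and> sqrt_boundary_time a x W \<omega> < \<infinity>}"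
proof -
  obtain K E where K: "0 \<le> K" and E: "E \<in> sets (F K)" "0 < prob E"
    and start: "\<And>\<omega>. \<omega> \<in> E \<Longrightarrow> \<exists>\<sigma>. 0 \<le> \<sigma> \<and> \<sigma> \<le> K \<and> hitting_time W (- x) \<omega> = ennreal \<sigma> \<and>
       (\<forall>s. \<sigma> \<le> s \<and> s \<le> K \<longrightarrow> x + W s \<omega> < a * sqrt (s - \<sigma> + 1)) \<and> x + W K \<omega> \<le> 0"
    using a by (rule start_event) (rule that, assumption+)
  have E': "E \<in> events" using E by (auto intro: sets_filtrationD)
  \<comment> \<open>From \<open>k0\<close> on, integers lie beyond \<open>K\<close> and hence beyond
    the hitting time, so a crossing there does stop the player.\<close>
  define k0 where "k0 = nat \<lceil>K\<rceil>"
  define C where "C = {\<omega> \<in> space M. \<forall>k\<ge>k0. x + W (real k) \<omega> < a * sqrt (real k + 1)}"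
  have C_sets: "C \<in> events"
    unfolding C_def by measurable
  have C_null: "C \<in> null_sets M"
    using sqrt_boundary_crossed[OF a, of k0 x] C_sets
    by (simp add: null_sets_def emeasure_eq_measure C_def[symmetric])
  show ?thesis
  proof (rule that[OF K E' E(2)])
    fix \<omega> assume "\<omega> \<in> E"
    from start[OF this] show "hitting_time W (- x) \<omega> \<le> ennreal K"
      by (auto simp: ennreal_leI)
  next
    fix u :: real assume u: "0 < u"
    let ?X = "{\<omega> \<in> space M. \<forall>r\<in>{0..u}. W (K + r) \<omega> - W K \<omega> < a * sqrt (r + 1)}"
    let ?T = "{\<omega> \<in> E. ennreal (K + u) < sqrt_boundary_time a x W \<omega> \<and> sqrt_boundary_time a x W \<omega> < \<infinity>}"
    have bdry: "continuous_on {0..u} (\<lambda>r. a * sqrt (r + 1))" by (intro continuous_intros)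
    have X_sets: "?X \<in> events"
      using K u bdry by (intro sets_filtrationD[OF sets_path_below(1)[of K u "K + u"]]) auto
    have "?T = E \<inter> {\<omega> \<in> space M. ennreal (K + u) < sqrt_boundary_time a x W \<omega> \<and> sqrt_boundary_time a x W \<omega> < \<infinity>}"
      using sets.sets_into_space[OF E'] by auto
    also have "\<dots> \<in> events" by (intro sets.Int E') measurable
    finally have T_sets: "?T \<in> events" .
    have "prob E * measure N {\<omega> \<in> space N. \<forall>r\<in>{0..u}. B r \<omega> < a * sqrt (r + 1)} = prob (E \<inter> ?X)"
      using markov_property[OF BM K u E(1) bdry] by simp
    also have "\<dots> = prob (E \<inter> ?X - C)"
      using E' X_sets C_null by (intro measure_Diff_null_set[symmetric]) auto
    also have "\<dots> \<le> prob ?T"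
    proof (intro finite_measure_mono T_sets subsetI)
      fix \<omega> assume \<omega>: "\<omega> \<in> E \<inter> ?X - C"
      then have sp: "\<omega> \<in> space M" by auto
      obtain \<sigma> where \<sigma>: "0 \<le> \<sigma>" "\<sigma> \<le> K" "hitting_time W (- x) \<omega> = ennreal \<sigma>"
        "\<And>s. \<sigma> \<le> s \<Longrightarrow> s \<le> K \<Longrightarrow> x + W s \<omega> < a * sqrt (s - \<sigma> + 1)" "x + W K \<omega> \<le> 0"
        using start[of \<omega>] \<omega> by blast
      obtain k where k: "k0 \<le> k" "a * sqrt (real k + 1) \<le> x + W (real k) \<omega>"
        using \<omega> sp by (auto simp: C_def not_less)
      have "K \<le> real k" using k(1) by (simp add: k0_def nat_le_iff ceiling_le_iff)
      \<comment> \<open>The crossing concerns the boundary counted from time 0, which dominates the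
        player's boundary.\<close>
      have "a * sqrt (real k - \<sigma> + 1) \<le> a * sqrt (real k + 1)"
        using a \<sigma> by (intro mult_left_mono) auto
      then have "sqrt_boundary_time a x W \<omega> \<le> ennreal (real k)"
        using \<sigma>(1,2) \<open>K \<le> real k\<close> k(2) by (intro sqrt_boundary_time_le[OF \<sigma>(3)]) auto
      then have fin: "sqrt_boundary_time a x W \<omega> < \<infinity>" by (simp add: order_le_less_trans)
      have "ennreal (K + u) < sqrt_boundary_time a x W \<omega>"
      proof (rule ccontr)
        assume "\<not> ?thesis"
        then have le: "sqrt_boundary_time a x W \<omega> \<le> ennreal (K + u)" by simp
        from continuous_path[OF sp] fin obtain \<sigma>' \<tau> where *: "0 \<le> \<sigma>'" "\<sigma>' \<le> \<tau>"
          "hitting_time W (- x) \<omega> = ennreal \<sigma>'"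
          "sqrt_boundary_time a x W \<omega> = ennreal \<tau>" "a * sqrt (\<tau> - \<sigma>' + 1) \<le> x + W \<tau> \<omega>"
          by (rule sqrt_boundary_time_finiteE) (rule that, assumption+)
        have "\<sigma>' = \<sigma>" using * \<sigma> by simp
        have "\<tau> \<le> K + u"
          using le K u unfolding *(4) by (subst (asm) ennreal_le_iff) auto
        show False
        proof (cases "\<tau> \<le> K")
          case True
          then show ?thesis using \<sigma>(4)[of \<tau>] * \<open>\<sigma>' = \<sigma>\<close> by simp
        next
          case False
          then have "W (K + (\<tau> - K)) \<omega> - W K \<omega> < a * sqrt ((\<tau> - K) + 1)"
            using \<omega> \<open>\<tau> \<le> K + u\<close> by (intro bspec[of "{0..u}" "\<lambda>r. W (K + r) \<omega> - W K \<omega> < a * sqrt (r + 1)"]) auto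
          also have "\<dots> \<le> a * sqrt (\<tau> - \<sigma> + 1)"
            using a \<sigma> by (intro mult_left_mono) auto
          finally show ?thesis using * \<open>\<sigma>' = \<sigma>\<close> \<sigma>(5) by simp
        qed
      qed
      then show "\<omega> \<in> ?T" using fin \<omega> by auto
    qed
    finally show "prob E * measure N {\<omega> \<in> space N. \<forall>r\<in>{0..u}. B r \<omega> < a * sqrt (r + 1)} \<le> prob ?T" .
  qed
qed

end

section \<open>Payoffs\<close>

lemma eventually_ge_powr:
  fixes f :: "real \<Rightarrow> real"
  assumes "0 < Liminf at_top (\<lambda>y. ereal (f y / y powr \<gamma>))"
  obtains e Y where "0 < e" "0 < Y" "\<And>y. Y \<le> y \<Longrightarrow> e * y powr \<gamma> \<le> f y"
proof -
  obtain e where e: "0 < ereal e" "ereal e < Liminf at_top (\<lambda>y. ereal (f y / y powr \<gamma>))"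
    using ereal_dense2[OF assms] by blast
  from less_LiminfD[OF e(2)] obtain Y where Y: "\<And>y. Y \<le> y \<Longrightarrow> e < f y / y powr \<gamma>"
    unfolding eventually_at_top_linorder by auto
  show ?thesis
  proof (rule that[of e "max Y 1"])
    fix y assume "max Y 1 \<le> y"
    then show "e * y powr \<gamma> \<le> f y" using Y[of y] by (simp add: field_simps)
  qed (use e in auto)
qed

text \<open>For payoffs: \<open>I\<close> does not depend on \<open>u\<close>, whereas the
  contributions of stops after \<open>u\<close> have unbounded lower bounds.\<close>

lemma powr_unbounded_eq_top:
  fixes I :: ennreal
  assumes "0 < A" "0 < q" and le: "\<And>u. U \<le> u \<Longrightarrow> ennreal (A * (u + 1) powr q) \<le> I"
  shows "I = \<infinity>"
proof (rule ccontr)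
  assume "I \<noteq> \<infinity>"
  then obtain R where R: "I = ennreal R" "0 \<le> R" by (cases I) auto
  have "filterlim (\<lambda>v. A * v powr q) at_top at_top"
    using assms by (intro filterlim_tendsto_pos_mult_at_top[OF tendsto_const] real_powr_at_top) auto
  then have "\<forall>\<^sub>F v in at_top. R < A * v powr q"
    by (simp add: filterlim_at_top_dense)
  then obtain v where v: "\<And>v'. v' \<ge> v \<Longrightarrow> R < A * v' powr q"
    unfolding eventually_at_top_linorder by blast
  define u where "u = max U v"
  have "A * (u + 1) powr q \<le> R"
    using le[of u] R by (simp add: u_def)
  moreover have "v \<le> u + 1" by (simp add: u_def)
  ultimately show False using v[of "u + 1"] by linarith
qed

lemma nn_integral_ge_event:
  assumes "prob_space M" "D \<in> sets M" "0 \<le> v" and ge: "\<And>\<omega>. \<omega> \<in> D \<Longrightarrow> v \<le> X \<omega>"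
  shows "ennreal (v * measure M D) \<le> (\<integral>\<^sup>+\<omega>. ennreal (X \<omega>) \<partial>M)"
proof -
  interpret prob_space M by fact
  have "ennreal (v * measure M D) = (\<integral>\<^sup>+\<omega>. ennreal v * indicator D \<omega> \<partial>M)"
    using assms by (simp add: nn_integral_cmult_indicator emeasure_eq_measure ennreal_mult)
  also have "\<dots> \<le> (\<integral>\<^sup>+\<omega>. ennreal (X \<omega>) \<partial>M)"
    using ge by (intro nn_integral_mono) (auto simp: indicator_def ennreal_leI)
  finally show ?thesis .
qed

text \<open>The negative part integrates to 0, so the case \<open>\<infinity> - \<infinity>\<close>
  cannot arise.\<close>

lemma ext_expectation_nonneg:
  assumes nonneg: "\<And>\<omega>. \<omega> \<in> space M \<Longrightarrow> 0 \<le> X \<omega>"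
  shows "expectation_well_defined M X" "(\<integral>\<^sup>+\<omega>. ennreal (X \<omega>) \<partial>M) = \<infinity> \<Longrightarrow> ext_expectation M X = \<infinity>"
proof -
  have "(\<integral>\<^sup>+\<omega>. ennreal (- X \<omega>) \<partial>M) = (\<integral>\<^sup>+\<omega>. 0 \<partial>M)"
    using nonneg by (intro nn_integral_cong) (simp add: ennreal_neg)
  then have 0: "(\<integral>\<^sup>+\<omega>. ennreal (- X \<omega>) \<partial>M) = 0" by simp
  then show "expectation_well_defined M X" by (simp add: expectation_well_defined_def)
  show "ext_expectation M X = \<infinity>" if "(\<integral>\<^sup>+\<omega>. ennreal (X \<omega>) \<partial>M) = \<infinity>"
    unfolding ext_expectation_def 0 that by simp
qed

text \<open>Stated for any admissible survival exponent \<open>b\<close>, so that it covers both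
  Breiman's exponent and the estimate proved directly. The third conclusion is for telling profiles
  apart, since stopping times for different \<open>a\<close> are strictly ordered where the earlier
  one is finite.\<close>

lemma sqrt_boundary_equilibrium:
  fixes M :: "'w measure" and W :: "'n::finite \<Rightarrow> real \<Rightarrow> 'w \<Rightarrow> real"
  assumes IBM: "independent_brownian_motions M W"
    and d: "\<forall>i. \<forall>\<tau>\<in>strategy_profiles M f x W. \<forall>t\<ge>0. 0 \<le> d i \<tau> t"
    and f_nonneg: "\<forall>y\<ge>0. f y \<ge> 0"
    and \<gamma>: "\<gamma> > 0" and growth: "Liminf at_top (\<lambda>y. ereal (f y / y powr \<gamma>)) > 0"
    and BM: "brownian_motion N B" and a: "0 < a"
    and b: "0 < b" "b < \<gamma> / (2 * real CARD('n))"
    and tail: "0 < c" "\<forall>u\<ge>u0.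
      c * (u + 1) powr - b \<le> measure N {\<omega> \<in> space N. \<forall>r\<in>{0..u}. B r \<omega> < a * sqrt (r + 1)}"
  shows "nash_equilibrium M f x W d (\<lambda>i. sqrt_boundary_time a (x i) (W i))"
    and "infinite_payoffs M f x W d (\<lambda>i. sqrt_boundary_time a (x i) (W i))"
    and "\<And>i. 0 < measure M {\<omega> \<in> space M. sqrt_boundary_time a (x i) (W i) \<omega> < \<infinity>}"
proof -
  have M: "prob_space M" using IBM by (simp add: independent_brownian_motions_def)
  interpret prob_space M by (rule M)
  have W: "brownian_motion M (W i)" for i
    using IBM by (intro brownian_motion.intro brownian_motion_axioms.intro M)
      (simp add: independent_brownian_motions_def)
  let ?T = "\<lambda>i. sqrt_boundary_time a (x i) (W i)"
  let ?n = "real CARD('n)"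
  let ?h = "\<lambda>u. measure N {\<omega> \<in> space N. \<forall>r\<in>{0..u}. B r \<omega> < a * sqrt (r + 1)}"
  have T_meas [measurable]: "?T i \<in> borel_measurable M" for i
    by (rule brownian_motion.measurable_sqrt_boundary_time[OF W])
  have cont: "continuous_on {0..} (\<lambda>t. W i t \<omega>)" if "\<omega> \<in> space M" for i \<omega>
    using brownian_motion.continuous_path[OF W that] .
  have reward_nonneg: "0 \<le> stopped_reward f (x i) (W i) (?T i) \<omega>" if \<omega>: "\<omega> \<in> space M" for i \<omega>
  proof (cases "?T i \<omega> = \<infinity>")
    case False
    then have "?T i \<omega> < \<infinity>" by (simp add: top.not_eq_extremum)
    with cont[OF \<omega>] obtain \<sigma> \<tau> where *: "0 \<le> \<sigma>" "\<sigma> \<le> \<tau>" "?T i \<omega> = ennreal \<tau>" "a * sqrt (\<tau> - \<sigma> + 1) \<le> x i + W i \<tau> \<omega>"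
      by (rule sqrt_boundary_time_finiteE) (rule that, assumption+)
    have "0 \<le> a * sqrt (\<tau> - \<sigma> + 1)" using a * by simp
    then have "0 \<le> x i + W i \<tau> \<omega>" using * by linarith
    then show ?thesis using * f_nonneg by (simp add: stopped_reward_def)
  qed (simp add: stopped_reward_def)
  have profile: "?T \<in> strategy_profiles M f x W"
    unfolding strategy_profiles_def admissible_times_def
    using brownian_motion.stopping_time_sqrt_boundary_time[OF W] reward_nonneg
    by (auto intro!: ext_expectation_nonneg(1))
  have weight: "(\<Prod>j\<in>UNIV - {i}. prob {\<omega> \<in> space M. ennreal t < ?T j \<omega>}) \<le> win_weight M d ?T i (ennreal t)"
    if "0 \<le> t" for i t
    using d profile that by (simp add: win_weight_def)
  have weight_nonneg: "0 \<le> win_weight M d ?T i t" for i t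
    using d profile by (auto simp: win_weight_def intro!: add_nonneg_nonneg prod_nonneg)
  have W_nonneg: "0 \<le> weighted_reward M f x W d ?T i \<omega>" if "\<omega> \<in> space M" for i \<omega>
    unfolding weighted_reward_def using reward_nonneg[OF that] weight_nonneg by (rule mult_nonneg_nonneg)

  \<comment> \<open>Bundles the survival statement so that \<open>K\<close> and \<open>E\<close> can
    be chosen for all players simultaneously.\<close>
  define P where "P i K E \<longleftrightarrow> 0 \<le> K \<and> E \<in> events \<and> 0 < prob E \<and>
      (\<forall>\<omega>\<in>E. hitting_time (W i) (- x i) \<omega> \<le> ennreal K) \<and>
      (\<forall>u>0. prob E * ?h u \<le> prob {\<omega> \<in> E. ennreal (K + u) < ?T i \<omega> \<and> ?T i \<omega> < \<infinity>})" for i K E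
  have "\<exists>K E. P i K E" for i
    unfolding P_def by (rule brownian_motion.survival_bound[OF W[of i] BM a, of "x i"]) blast
  then obtain K E where KE: "\<And>i. P i (K i) (E i)"
    by metis
  have K: "0 \<le> K i" and E: "E i \<in> events" "0 < prob (E i)" for i
    using KE[of i] by (auto simp: P_def)
  have hit: "hitting_time (W i) (- x i) \<omega> \<le> ennreal (K i)" if "\<omega> \<in> E i" for i \<omega>
    using KE[of i] that unfolding P_def by blast
  have surv: "prob (E i) * ?h u \<le> prob {\<omega> \<in> E i. ennreal (K i + u) < ?T i \<omega> \<and> ?T i \<omega> < \<infinity>}"
    if "0 < u" for i u
    using KE[of i] that unfolding P_def by blast
  define D where "D i u = {\<omega> \<in> E i. ennreal (K i + u) < ?T i \<omega> \<and> ?T i \<omega> < \<infinity>}" for i u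
  have D_sets: "D i u \<in> events" for i u
  proof -
    have "D i u = E i \<inter> {\<omega> \<in> space M. ennreal (K i + u) < ?T i \<omega> \<and> ?T i \<omega> < \<infinity>}"
      using sets.sets_into_space[OF E(1)] by (auto simp: D_def)
    also have "\<dots> \<in> events" by (intro sets.Int E) measurable
    finally show ?thesis .
  qed
  have D_prob: "prob (E i) * (c * (u + 1) powr - b) \<le> prob (D i u)" if "u0 \<le> u" "0 < u" for i u
  proof -
    have "prob (E i) * (c * (u + 1) powr - b) \<le> prob (E i) * ?h u"
      using tail(2) that(1) by (intro mult_left_mono) auto
    also have "\<dots> \<le> prob (D i u)" unfolding D_def by (rule surv[OF that(2)])
    finally show ?thesis .
  qed
  \<comment> \<open>With finitely many players one positive constant serves all of them.\<close>
  define c0 where "c0 = Min (range (\<lambda>i. prob (E i) * c))"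
  have c0: "0 < c0" "\<And>i. c0 \<le> prob (E i) * c"
    using E(2) tail(1) by (auto simp: c0_def)
  \<comment> \<open>A common time from which every player's shifted horizon \<open>t - K i\<close>
    is positive and at least \<open>u0\<close>. The shift costs nothing below, because the exponent
    \<open>- b\<close> is negative.\<close>
  define t0 where "t0 = Max (range K) + max u0 0 + 1"
  have t0: "K i + max u0 0 + 1 \<le> t0" for i
    unfolding t0_def by (simp add: Max_ge)
  have T_prob: "c0 * (t + 1) powr - b \<le> prob {\<omega> \<in> space M. ennreal t < ?T i \<omega>}" if "t0 \<le> t" for i t
  proof -
    have u: "u0 \<le> t - K i" "0 < t - K i" using t0[of i] that by linarith+
    have "c0 * (t + 1) powr - b \<le> (prob (E i) * c) * (t - K i + 1) powr - b"
      using c0 u K[of i] b tail(1) by (intro mult_mono powr_mono2') auto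
    also have "\<dots> \<le> prob (D i (t - K i))" using D_prob[OF u, of i] by (simp add: mult.assoc)
    also have "\<dots> \<le> prob {\<omega> \<in> space M. ennreal t < ?T i \<omega>}"
      using sets.sets_into_space[OF E(1)] by (intro finite_measure_mono) (auto simp: D_def)
    finally show ?thesis .
  qed
  have prod_bound: "c0 ^ (CARD('n) - 1) * (t + 1) powr (- b * (?n - 1)) \<le>
      (\<Prod>j\<in>UNIV - {i}. prob {\<omega> \<in> space M. ennreal t < ?T j \<omega>})" if t: "t0 \<le> t" for i t
  proof -
    have "0 < t" using t0[of i] t K[of i] by linarith
    have "(\<Prod>j\<in>UNIV - {i}. c0 * (t + 1) powr - b) \<le> (\<Prod>j\<in>UNIV - {i}. prob {\<omega> \<in> space M. ennreal t < ?T j \<omega>})"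
      using T_prob[OF t] c0 by (intro prod_mono) auto
    moreover have "(\<Prod>j\<in>UNIV - {i}. c0 * (t + 1) powr - b) = c0 ^ (CARD('n) - 1) * ((t + 1) powr - b) ^ (CARD('n) - 1)"
      by (simp add: power_mult_distrib card_Diff_singleton)
    moreover have "((t + 1) powr - b) ^ (CARD('n) - 1) = (t + 1) powr (- b * (?n - 1))"
      using \<open>0 < t\<close> by (simp add: powr_realpow[symmetric] powr_powr of_nat_diff)
    ultimately show ?thesis by simp
  qed
  obtain e Y where eY: "0 < e" "0 < Y" "\<And>y. Y \<le> y \<Longrightarrow> e * y powr \<gamma> \<le> f y"
    using growth by (rule eventually_ge_powr) (rule that, assumption+)
  \<comment> \<open>Growth of the reward minus the loss from the other players' survival factors.
    The player's own survival costs another \<open>b\<close>, and \<open>b < p\<close> is exactly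
    \<open>b * ?n < \<gamma> / 2\<close>.\<close>
  define p where "p = \<gamma> / 2 - b * (?n - 1)"
  have "b * ?n < \<gamma> / 2" using b(2) by (simp add: field_simps)
  then have p: "b < p" by (simp add: p_def algebra_simps)
  define A where "A = e * (a / sqrt 2) powr \<gamma> * c0 ^ (CARD('n) - 1)"
  have A: "0 < A" using eY a c0 by (simp add: A_def)
  have gain: "A * (u + 1) powr p \<le> weighted_reward M f x W d ?T i \<omega>"
    if \<omega>: "\<omega> \<in> D i u" and u: "t0 \<le> u" "2 * K i + 1 \<le> u" "2 * (Y / a)\<^sup>2 \<le> u" for i u \<omega>
  proof -
    have sp: "\<omega> \<in> space M" using \<omega> sets.sets_into_space[OF D_sets] by blast
    have fin: "?T i \<omega> < \<infinity>" using \<omega> by (simp add: D_def)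
    from cont[OF sp] fin obtain \<sigma> \<tau> where *: "0 \<le> \<sigma>" "\<sigma> \<le> \<tau>" "hitting_time (W i) (- x i) \<omega> = ennreal \<sigma>"
        "?T i \<omega> = ennreal \<tau>" "a * sqrt (\<tau> - \<sigma> + 1) \<le> x i + W i \<tau> \<omega>"
      by (rule sqrt_boundary_time_finiteE) (rule that, assumption+)
    have "\<sigma> \<le> K i" using hit[of \<omega> i] \<omega> * K[of i] by (simp add: D_def)
    have "0 < u" using u K[of i] by linarith
    have "ennreal (K i + u) < ennreal \<tau>" using \<omega> *(4) by (simp add: D_def)
    then have \<tau>: "K i + u < \<tau>"
      using K[of i] \<open>0 < u\<close> by (subst (asm) ennreal_less_iff) auto
    \<comment> \<open>A lower bound for the height that no longer contains \<open>\<sigma>\<close>: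
      as \<open>\<sigma> \<le> K i\<close> and \<open>2 * K i + 1 \<le> u < \<tau>\<close>, at least
      half of \<open>\<tau> + 1\<close> remains after the hitting time. This is the source of
      \<open>sqrt 2\<close> in \<open>A\<close>.\<close>
    define y where "y = a * sqrt ((\<tau> + 1) / 2)"
    have y_eq: "y = (a / sqrt 2) * sqrt (\<tau> + 1)" by (simp add: y_def real_sqrt_divide)
    have "y \<le> a * sqrt (\<tau> - \<sigma> + 1)"
      unfolding y_def using a \<tau> u K[of i] \<open>\<sigma> \<le> K i\<close> by (intro mult_left_mono real_sqrt_le_mono) auto
    then have y_le: "y \<le> x i + W i \<tau> \<omega>" using * by simp
    \<comment> \<open>The third lower bound on \<open>u\<close> is made for this: it lifts the
      height into the range where \<open>f\<close> dominates
      \<open>e * y powr \<gamma>\<close>.\<close>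
    have "Y / a \<le> sqrt ((\<tau> + 1) / 2)"
      using u \<tau> K[of i] by (intro real_le_rsqrt) auto
    then have Y_le: "Y \<le> y" using a by (simp add: y_def field_simps)
    have "e * (a / sqrt 2) powr \<gamma> * (\<tau> + 1) powr (\<gamma> / 2) = e * y powr \<gamma>"
    proof -
      have "sqrt (\<tau> + 1) powr \<gamma> = (\<tau> + 1) powr (\<gamma> / 2)"
        using * by (simp add: powr_half_sqrt[symmetric] powr_powr)
      then show ?thesis
        unfolding y_eq using a * by (subst powr_mult) auto
    qed
    also have "\<dots> \<le> e * (x i + W i \<tau> \<omega>) powr \<gamma>"
      using eY Y_le y_le \<gamma> by (intro mult_left_mono powr_mono2) auto
    also have "\<dots> \<le> f (x i + W i \<tau> \<omega>)"
      using Y_le y_le by (intro eY(3)) auto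
    also have "\<dots> = stopped_reward f (x i) (W i) (?T i) \<omega>"
      using * by (simp add: stopped_reward_def)
    finally have reward: "e * (a / sqrt 2) powr \<gamma> * (\<tau> + 1) powr (\<gamma> / 2) \<le> stopped_reward f (x i) (W i) (?T i) \<omega>" .
    have "t0 \<le> \<tau>" using \<tau> u K[of i] by linarith
    have wt: "c0 ^ (CARD('n) - 1) * (\<tau> + 1) powr (- b * (?n - 1)) \<le> win_weight M d ?T i (?T i \<omega>)"
      using prod_bound[OF \<open>t0 \<le> \<tau>\<close>, of i] weight[of \<tau> i] * by (simp only:) linarith
    \<comment> \<open>Since \<open>p\<close> is positive, the bound at the random time
      \<open>\<tau>\<close> may be replaced by its value at \<open>u\<close>.\<close>
    have "A * (u + 1) powr p \<le> A * (\<tau> + 1) powr p"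
      using A p b \<tau> K[of i] \<open>0 < u\<close> by (intro mult_left_mono powr_mono2) auto
    also have "\<dots> = (e * (a / sqrt 2) powr \<gamma> * (\<tau> + 1) powr (\<gamma> / 2)) *
        (c0 ^ (CARD('n) - 1) * (\<tau> + 1) powr (- b * (?n - 1)))"
      by (simp add: A_def p_def powr_add[symmetric] mult_ac)
    also have "\<dots> \<le> weighted_reward M f x W d ?T i \<omega>"
      unfolding weighted_reward_def
      using reward wt reward_nonneg[OF sp] c0(1) eY(1) by (intro mult_mono) auto
    finally show ?thesis .
  qed
  have "(\<integral>\<^sup>+\<omega>. ennreal (weighted_reward M f x W d ?T i \<omega>) \<partial>M) = \<infinity>" for i
  proof (rule powr_unbounded_eq_top)
    show "0 < A * (prob (E i) * c)" "0 < p - b" using A E(2) tail(1) p by auto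
    fix u assume "Max {t0, 2 * K i + 1, 2 * (Y / a)\<^sup>2} \<le> u"
    then have u: "t0 \<le> u" "2 * K i + 1 \<le> u" "2 * (Y / a)\<^sup>2 \<le> u" by auto
    have u': "u0 \<le> u" "0 < u" using t0[of i] u K[of i] by linarith+
    have "A * (prob (E i) * c) * (u + 1) powr (p - b) = A * (u + 1) powr p * (prob (E i) * (c * (u + 1) powr - b))"
      by (simp add: powr_diff powr_minus field_simps)
    also have "\<dots> \<le> A * (u + 1) powr p * prob (D i u)"
      using D_prob[OF u'] A by (intro mult_left_mono) auto
    finally have "ennreal (A * (prob (E i) * c) * (u + 1) powr (p - b)) \<le> ennreal (A * (u + 1) powr p * prob (D i u))"
      by (rule ennreal_leI)
    also have "\<dots> \<le> (\<integral>\<^sup>+\<omega>. ennreal (weighted_reward M f x W d ?T i \<omega>) \<partial>M)"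
      using gain[OF _ u] A by (intro nn_integral_ge_event M D_sets) auto
    finally show "ennreal (A * (prob (E i) * c) * (u + 1) powr (p - b)) \<le> (\<integral>\<^sup>+\<omega>. ennreal (weighted_reward M f x W d ?T i \<omega>) \<partial>M)" .
  qed
  then have payoff: "payoff M f x W d ?T i = \<infinity>" for i
    unfolding payoff_def using W_nonneg by (intro ext_expectation_nonneg(2)) auto
  show "infinite_payoffs M f x W d ?T"
    unfolding infinite_payoffs_def
    by (intro allI conjI ext_expectation_nonneg(1) W_nonneg payoff)
  show "nash_equilibrium M f x W d ?T"
    unfolding nash_equilibrium_def using profile payoff by simp
  show "0 < measure M {\<omega> \<in> space M. ?T i \<omega> < \<infinity>}" for i
  proof -
    define u where "u = max u0 1"
    have "0 < prob (E i) * (c * (u + 1) powr - b)"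
      using E(2) tail(1) by (simp add: u_def)
    also have "\<dots> \<le> prob (D i u)" by (rule D_prob) (auto simp: u_def)
    also have "\<dots> \<le> prob {\<omega> \<in> space M. ?T i \<omega> < \<infinity>}"
      using sets.sets_into_space[OF E(1)] by (intro finite_measure_mono) (auto simp: D_def)
    finally show ?thesis .
  qed
qed

section \<open>Infinitely many equilibria, and the equilibria given by Breiman's exponent\<close>

theorem mainTheorem3:
  fixes M :: "'\<omega> measure"
    and W :: "'n::finite \<Rightarrow> real \<Rightarrow> '\<omega> \<Rightarrow> real"
    and f :: "real \<Rightarrow> real"
    and x :: "'n \<Rightarrow> real"
    and d :: "'n \<Rightarrow> ('n \<Rightarrow> '\<omega> \<Rightarrow> ennreal) \<Rightarrow> real \<Rightarrow> real"
    and \<gamma> :: real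
    and N :: "'b measure"
    and B :: "real \<Rightarrow> 'b \<Rightarrow> real"
  assumes "independent_brownian_motions M W"
    and "f \<in> borel_measurable borel"
    and "\<And>i \<tau> t. \<tau> \<in> strategy_profiles M f x W \<Longrightarrow> 0 \<le> t \<Longrightarrow> 0 \<le> d i \<tau> t"
    and "\<And>y. y < 0 \<Longrightarrow> f y < 0"
    and "\<And>y. y \<ge> 0 \<Longrightarrow> f y \<ge> 0"
    and "\<gamma> > 0"
    and "Liminf at_top (\<lambda>y. ereal (f y / y powr \<gamma>)) > 0"
    and "standard_brownian_motion N B"
  shows "(\<exists>S. infinite S \<and>
            (\<forall>\<tau>\<in>S. nash_equilibrium M f x W d \<tau> \<and> infinite_payoffs M f x W d \<tau>) \<and>
            pairwise (\<lambda>\<tau> \<rho>. \<not> (AE \<omega> in M. \<forall>i. \<tau> i \<omega> = \<rho> i \<omega>)) S)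
       \<and> (\<forall>\<beta> a. breiman_exponent N B \<beta> \<and> a > 0 \<and> \<beta> a < \<gamma> / (2 * real CARD('n)) \<longrightarrow>
            nash_equilibrium M f x W d (\<lambda>i. sqrt_boundary_time a (x i) (W i)) \<and>
            infinite_payoffs M f x W d (\<lambda>i. sqrt_boundary_time a (x i) (W i)))"
proof (intro conjI allI impI)
  let ?T = "\<lambda>a i. sqrt_boundary_time a (x i) (W i)"
  have M: "prob_space M" using assms(1) by (simp add: independent_brownian_motions_def)
  have W: "brownian_motion M (W i)" for i
    using assms(1) by (intro brownian_motion.intro brownian_motion_axioms.intro M)
      (simp add: independent_brownian_motions_def)
  have BM: "brownian_motion N B"
    using assms(8) by (intro brownian_motion.intro brownian_motion_axioms.intro)
      (auto simp: standard_brownian_motion_def)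
  interpret prob_space M by (rule M)
  interpret N: brownian_motion N B by (rule BM)
  have d: "\<forall>i. \<forall>\<tau>\<in>strategy_profiles M f x W. \<forall>t\<ge>0. 0 \<le> d i \<tau> t" and f: "\<forall>y\<ge>0. f y \<ge> 0"
    using assms(3,5) by blast+
  note equilibrium = sqrt_boundary_equilibrium[OF assms(1) d f assms(6,7) BM]
  show "\<exists>S. infinite S \<and>
            (\<forall>\<tau>\<in>S. nash_equilibrium M f x W d \<tau> \<and> infinite_payoffs M f x W d \<tau>) \<and>
            pairwise (\<lambda>\<tau> \<rho>. \<not> (AE \<omega> in M. \<forall>i. \<tau> i \<omega> = \<rho> i \<omega>)) S"
  proof -
    \<comment> \<open>Half of the critical exponent; any positive number below the critical one
      leads to an infinite payoff.\<close>
    define b where "b = \<gamma> / (4 * real CARD('n))"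
    have b: "0 < b" "b < \<gamma> / (2 * real CARD('n))"
      using assms(6) by (auto simp: b_def field_simps)
    obtain a0 where a0: "0 < a0" and tail: "\<And>a. a0 \<le> a \<Longrightarrow> \<exists>c>0. \<forall>u\<ge>0.
        c * (u + 1) powr - b \<le> measure N {\<omega> \<in> space N. \<forall>r\<in>{0..u}. B r \<omega> < a * sqrt (r + 1)}"
      using N.sqrt_boundary_tail[OF b(1)] by blast
    have eq: "nash_equilibrium M f x W d (?T a) \<and> infinite_payoffs M f x W d (?T a) \<and>
        (\<forall>i. 0 < prob {\<omega> \<in> space M. ?T a i \<omega> < \<infinity>})" if "a0 \<le> a" for a
    proof -
      obtain c where c: "0 < c" "\<forall>u\<ge>0.
          c * (u + 1) powr - b \<le> measure N {\<omega> \<in> space N. \<forall>r\<in>{0..u}. B r \<omega> < a * sqrt (r + 1)}"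
        using tail[OF \<open>a0 \<le> a\<close>] by blast
      have "0 < a" using a0 that by simp
      from equilibrium[OF this b c] show ?thesis by blast
    qed
    have neq: "\<not> (AE \<omega> in M. \<forall>i. ?T a i \<omega> = ?T a' i \<omega>)" if a: "a0 \<le> a" "a < a'" for a a'
    proof
      \<comment> \<open>A single player suffices, and there is one because types are inhabited.
        Equality almost everywhere would contradict the strict ordering of the times unless this
        player almost surely never stops.\<close>
      fix i :: 'n
      assume "AE \<omega> in M. \<forall>i. ?T a i \<omega> = ?T a' i \<omega>"
      then have "AE \<omega> in M. \<omega> \<notin> {\<omega> \<in> space M. ?T a i \<omega> < \<infinity>}"
        using AE_space
      proof eventually_elim
        fix \<omega> assume "\<forall>i. ?T a i \<omega> = ?T a' i \<omega>" "\<omega> \<in> space M"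
        then show "\<omega> \<notin> {\<omega> \<in> space M. ?T a i \<omega> < \<infinity>}"
          using sqrt_boundary_time_less[of "W i" \<omega> a a' "x i"]
            brownian_motion.continuous_path[OF W[of i], of \<omega>] a a0 by auto
      qed
      then have "prob {\<omega> \<in> space M. ?T a i \<omega> < \<infinity>} = 0"
        using brownian_motion.measurable_sqrt_boundary_time[OF W[of i], of a "x i"]
        by (subst prob_eq_0) auto
      then show False using eq[OF a(1)] by (metis less_irrefl)
    qed
    have neq': "\<not> (AE \<omega> in M. \<forall>i. ?T a i \<omega> = ?T a' i \<omega>)" if "a0 \<le> a" "a0 \<le> a'" "a \<noteq> a'" for a a'
    proof (cases "a < a'")
      case True
      then show ?thesis using neq that by blast
    next
      case False
      then have "\<not> (AE \<omega> in M. \<forall>i. ?T a' i \<omega> = ?T a i \<omega>)" using neq[of a' a] that by simp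
      then show ?thesis by (simp add: eq_commute)
    qed
    have "inj_on ?T {a0..}"
    proof (rule inj_onI, rule ccontr)
      fix a a' assume "a \<in> {a0..}" "a' \<in> {a0..}" and T: "?T a = ?T a'" and "a \<noteq> a'"
      then have "\<not> (AE \<omega> in M. \<forall>i. ?T a i \<omega> = ?T a' i \<omega>)" by (intro neq') auto
      moreover have "?T a i \<omega> = ?T a' i \<omega>" for i \<omega> using T by (metis (no_types, lifting))
      ultimately show False by simp
    qed
    then have "infinite (?T ` {a0..})"
      using infinite_Ici[of a0] by (simp add: finite_image_iff)
    moreover have "pairwise (\<lambda>\<tau> \<rho>. \<not> (AE \<omega> in M. \<forall>i. \<tau> i \<omega> = \<rho> i \<omega>)) (?T ` {a0..})"
      using neq' by (auto simp: pairwise_def)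
    moreover have "\<forall>\<tau>\<in>?T ` {a0..}. nash_equilibrium M f x W d \<tau> \<and> infinite_payoffs M f x W d \<tau>"
      using eq by auto
    ultimately show ?thesis by blast
  qed
  fix \<beta> :: "real \<Rightarrow> real" and a :: real
  assume asm: "breiman_exponent N B \<beta> \<and> a > 0 \<and> \<beta> a < \<gamma> / (2 * real CARD('n))"
  then have \<beta>: "0 < \<beta> a" and a: "0 < a" by (auto simp: breiman_exponent_def)
  from asm obtain c where c: "0 < c" "\<forall>\<^sub>F t in at_top.
      c * t powr (- \<beta> a) \<le> measure N {\<omega> \<in> space N. breiman_time a B \<omega> > ennreal (t - 1)}"
    unfolding breiman_exponent_def by blast
  from c(2) obtain t1 where t1: "\<And>t. t1 \<le> t \<Longrightarrow>
      c * t powr (- \<beta> a) \<le> measure N {\<omega> \<in> space N. breiman_time a B \<omega> > ennreal (t - 1)}"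
    unfolding eventually_at_top_linorder by blast
  have tail: "c * (u + 1) powr - \<beta> a \<le> measure N {\<omega> \<in> space N. \<forall>r\<in>{0..u}. B r \<omega> < a * sqrt (r + 1)}"
    if u: "max t1 0 \<le> u" for u
  proof -
    \<comment> \<open>Taking \<open>t = u + 1\<close> turns the horizon \<open>t - 1\<close> in
      Breiman's estimate into \<open>u\<close>. Surviving strictly beyond \<open>u\<close> then
      means a strict inequality on all of \<open>{0..u}\<close>, including the endpoint.\<close>
    have "c * (u + 1) powr - \<beta> a \<le> measure N {\<omega> \<in> space N. breiman_time a B \<omega> > ennreal u}"
      using t1[of "u + 1"] u by simp
    also have "\<dots> \<le> measure N {\<omega> \<in> space N. \<forall>r\<in>{0..u}. B r \<omega> < a * sqrt (r + 1)}"
    proof (rule N.finite_measure_mono)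
      show "{\<omega> \<in> space N. \<forall>r\<in>{0..u}. B r \<omega> < a * sqrt (r + 1)} \<in> sets N"
        using u by (intro N.sets_filtrationD[OF N.sets_path_below(2)[of 0 u u]] continuous_intros) auto
      have "B r \<omega> < a * sqrt (r + 1)" if "breiman_time a B \<omega> > ennreal u" "0 \<le> r" "r \<le> u" for r \<omega>
      proof (rule ccontr)
        assume "\<not> ?thesis"
        then have "breiman_time a B \<omega> \<le> ennreal r"
          unfolding breiman_time_def using that by (intro Inf_lower) auto
        also have "\<dots> \<le> ennreal u" using that by (intro ennreal_leI)
        finally show False using that by simp
      qed
      then show "{\<omega> \<in> space N. breiman_time a B \<omega> > ennreal u} \<subseteq> {\<omega> \<in> space N. \<forall>r\<in>{0..u}. B r \<omega> < a * sqrt (r + 1)}"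
        by auto
    qed
    finally show ?thesis .
  qed
  show "nash_equilibrium M f x W d (?T a)" "infinite_payoffs M f x W d (?T a)"
    using equilibrium(1,2)[OF a \<beta> _ c(1), of "max t1 0"] asm tail by auto
qed

end
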